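(* Let $n\geq 2$ be an integer and let $\mathrm{D}_{2n}=\langle a,b\mid a^n=b^2=1,\ bab=a^{-1}\rangle$ be the dihedral group of order $2n$. Then the following are equivalent: (1) $\mathrm{D}_{2n}$ is an NDCI-group; (2) $\mathrm{D}_{2n}$ is an NCI-group; (3) either $n\in\{2,4\}$ or $n$ is odd.
   Context: All groups and (di)graphs are finite. For a group $G$ and a subset $S\subseteq G$ with $1\notin S$, the Cayley digraph $\mathrm{Cay}(G,S)$ has vertex set $G$ and arc set $\{(g,sg)\mid g\in G,\ s\in S\}$; if $S=S^{-1}$ it is regarded as an undirected graph (Cayley graph). For $g\in G$, $R(g)$ is the permutation $x\mapsto xg$ of $G$, and $R(G)=\{R(g)\mid g\in G\}$. $\mathrm{Cay}(G,S)$ is normal if $R(G)$ is a normal subgroup of $\mathrm{Aut}(\mathrm{Cay}(G,S))$. $\mathrm{Cay}(G,S)$ is a CI-digraph (CI-graph if $S=S^{-1}$) if whenever $\mathrm{Cay}(G,S)\cong\mathrm{Cay}(G,T)$ for some $T\subseteq G$ with $1\notin T$, there exists $\alpha\in\mathrm{Aut}(G)$ with $S^\alpha=T$. A group $G$ is an NDCI-group if every normal Cayley digraph of $G$ is a CI-digraph, and an NCI-group if every normal Cayley graph of $G$ is a CI-graph. *)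

theory Defs
  imports "HOL-Algebra.Algebra" "Graph_Theory.Graph_Theory"
begin

section \<open>Cayley digraphs\<close>

definition Cay :: "('a, 'm) monoid_scheme \<Rightarrow> 'a set \<Rightarrow> 'a pair_pre_digraph" where
  "Cay G S = \<lparr>pverts = carrier G, parcs = {(g, s \<otimes>\<^bsub>G\<^esub> g) | g s. g \<in> carrier G \<and> s \<in> S}\<rparr>"

definition connection_set :: "('a, 'm) monoid_scheme \<Rightarrow> 'a set \<Rightarrow> bool" where
  "connection_set G S \<longleftrightarrow> S \<subseteq> carrier G \<and> \<one>\<^bsub>G\<^esub> \<notin> S"

definition digraph_auts :: "'a pair_pre_digraph \<Rightarrow> ('a \<Rightarrow> 'a) set" where
  "digraph_auts \<Gamma> = {f \<in> Bij (pverts \<Gamma>).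
     \<forall>u\<in>pverts \<Gamma>. \<forall>v\<in>pverts \<Gamma>. (f u, f v) \<in> parcs \<Gamma> \<longleftrightarrow> (u, v) \<in> parcs \<Gamma>}"

definition digraph_aut_group :: "'a pair_pre_digraph \<Rightarrow> ('a \<Rightarrow> 'a) monoid" where
  "digraph_aut_group \<Gamma> = (BijGroup (pverts \<Gamma>))\<lparr>carrier := digraph_auts \<Gamma>\<rparr>"

text \<open>\<open>BijGroup\<close> composes maps from right to left, so \<open>right_mult G\<close> is an anti-homomorphism into it;
  whether its image is a normal subgroup does not depend on that convention.\<close>

definition right_mult :: "('a, 'm) monoid_scheme \<Rightarrow> 'a \<Rightarrow> 'a \<Rightarrow> 'a" where
  "right_mult G g = (\<lambda>x\<in>carrier G. x \<otimes>\<^bsub>G\<^esub> g)"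

definition right_regular :: "('a, 'm) monoid_scheme \<Rightarrow> ('a \<Rightarrow> 'a) set" where
  "right_regular G = right_mult G ` carrier G"

definition normal_Cay :: "('a, 'm) monoid_scheme \<Rightarrow> 'a set \<Rightarrow> bool" where
  "normal_Cay G S \<longleftrightarrow> right_regular G \<lhd> digraph_aut_group (Cay G S)"

text \<open>The same condition defines CI-digraphs and, for inverse-closed \<open>S\<close>, CI-graphs: an
  undirected graph is identified with the corresponding symmetric digraph.\<close>

definition CI_Cay :: "('a, 'm) monoid_scheme \<Rightarrow> 'a set \<Rightarrow> bool" where
  "CI_Cay G S \<longleftrightarrow>
     (\<forall>T. connection_set G T \<and> digraph_iso (with_proj (Cay G S)) (with_proj (Cay G T))
        \<longrightarrow> (\<exists>\<alpha>\<in>auto G. \<alpha> ` S = T))"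

definition NDCI_group :: "('a, 'm) monoid_scheme \<Rightarrow> bool" where
  "NDCI_group G \<longleftrightarrow> (\<forall>S. connection_set G S \<and> normal_Cay G S \<longrightarrow> CI_Cay G S)"

definition NCI_group :: "('a, 'm) monoid_scheme \<Rightarrow> bool" where
  "NCI_group G \<longleftrightarrow>
     (\<forall>S. connection_set G S \<and> set_inv\<^bsub>G\<^esub> S = S \<and> normal_Cay G S \<longrightarrow> CI_Cay G S)"

text \<open>\<open>digraph_iso\<close> allows arbitrary arc maps; for Cayley digraphs it reduces to the usual notion.\<close>

lemma digraph_iso_Cay_iff:
  assumes "group G" "connection_set G S" "connection_set G T"
  shows "digraph_iso (with_proj (Cay G S)) (with_proj (Cay G T)) \<longleftrightarrow>
    (\<exists>f. bij_betw f (carrier G) (carrier G) \<and>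
      (\<forall>u\<in>carrier G. \<forall>v\<in>carrier G. (u, v) \<in> parcs (Cay G S) \<longleftrightarrow> (f u, f v) \<in> parcs (Cay G T)))"
    (is "?L \<longleftrightarrow> ?R")
proof -
  interpret group G by fact
  have sub: "parcs (Cay G S) \<subseteq> carrier G \<times> carrier G" "parcs (Cay G T) \<subseteq> carrier G \<times> carrier G"
    using assms(2,3) by (auto simp: Cay_def connection_set_def)
  have V: "pverts (Cay G S) = carrier G" "pverts (Cay G T) = carrier G"
    by (auto simp: Cay_def)
  show ?thesis
  proof
    assume ?L
    then obtain h where h: "pre_digraph.digraph_isomorphism (with_proj (Cay G S)) h"
      and e: "with_proj (Cay G T) = app_iso h (with_proj (Cay G S))"
      by (auto simp: digraph_iso_def)
    have t: "iso_verts h ` carrier G = carrier G" "parcs (Cay G T) = iso_arcs h ` parcs (Cay G S)"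
      "iso_tail h = fst" "iso_head h = snd"
      using e V by (auto simp: app_iso_def with_proj_def)
    have inj: "inj_on (iso_verts h) (carrier G)"
      and arc: "\<And>a. a \<in> parcs (Cay G S) \<Longrightarrow> iso_arcs h a = (iso_verts h (fst a), iso_verts h (snd a))"
      using h V t by (auto simp: pre_digraph.digraph_isomorphism_def prod_eq_iff)
    have "(u, v) \<in> parcs (Cay G S) \<longleftrightarrow> (iso_verts h u, iso_verts h v) \<in> parcs (Cay G T)"
      if "u \<in> carrier G" "v \<in> carrier G" for u v
    proof
      assume "(u, v) \<in> parcs (Cay G S)"
      then show "(iso_verts h u, iso_verts h v) \<in> parcs (Cay G T)"
        using t(2) arc[of "(u,v)"] by force
    next
      assume "(iso_verts h u, iso_verts h v) \<in> parcs (Cay G T)"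
      then obtain x y where xy: "(x, y) \<in> parcs (Cay G S)"
        "(iso_verts h u, iso_verts h v) = iso_arcs h (x, y)"
        using t(2) by auto
      moreover have "x \<in> carrier G" "y \<in> carrier G" using xy(1) sub by auto
      ultimately have "u = x" "v = y"
        using arc[OF xy(1)] that inj by (auto dest: inj_onD)
      then show "(u, v) \<in> parcs (Cay G S)" using xy(1) by simp
    qed
    then show ?R using inj t(1) by (auto simp: bij_betw_def)
  next
    assume ?R
    then obtain f where f: "bij_betw f (carrier G) (carrier G)"
      and a: "\<And>u v. u \<in> carrier G \<Longrightarrow> v \<in> carrier G \<Longrightarrow>
        (u, v) \<in> parcs (Cay G S) \<longleftrightarrow> (f u, f v) \<in> parcs (Cay G T)" by blast
    define h where "h = \<lparr>iso_verts = f, iso_arcs = map_prod f f, iso_head = snd, iso_tail = fst\<rparr>"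
    have inj: "inj_on f (carrier G)" and sur: "f ` carrier G = carrier G"
      using f by (auto simp: bij_betw_def)
    have "inj_on (map_prod f f) (parcs (Cay G S))"
      using map_prod_inj_on[OF inj inj] sub(1) inj_on_subset by blast
    then have "pre_digraph.digraph_isomorphism (with_proj (Cay G S)) h"
      using inj sub by (auto simp: pre_digraph.digraph_isomorphism_def h_def V wf_digraph_def)
    moreover have "parcs (Cay G T) = map_prod f f ` parcs (Cay G S)"
    proof (intro equalityI subsetI)
      fix e assume e: "e \<in> parcs (Cay G T)"
      obtain x y where [simp]: "e = (x, y)" by (cases e)
      have "x \<in> f ` carrier G" "y \<in> f ` carrier G" using e sub sur by auto
      then obtain u v where uv: "u \<in> carrier G" "v \<in> carrier G" "x = f u" "y = f v" by blast
      then have "(u, v) \<in> parcs (Cay G S)" using e a by simp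
      then show "e \<in> map_prod f f ` parcs (Cay G S)" using uv by force
    qed (use a sub in auto)
    then have "with_proj (Cay G T) = app_iso h (with_proj (Cay G S))"
      using sur V by (auto simp: app_iso_def with_proj_def h_def)
    ultimately show ?L unfolding digraph_iso_def by blast
  qed
qed

lemma subgroup_digraph_auts: "subgroup (digraph_auts \<Gamma>) (BijGroup (pverts \<Gamma>))"
proof -
  interpret B: group "BijGroup (pverts \<Gamma>)" by (rule group_BijGroup)
  show ?thesis
  proof (rule B.subgroupI)
    show "digraph_auts \<Gamma> \<subseteq> carrier (BijGroup (pverts \<Gamma>))"
      by (auto simp: digraph_auts_def BijGroup_def)
    have "(\<lambda>x\<in>pverts \<Gamma>. x) \<in> digraph_auts \<Gamma>"
      using id_Bij[of "pverts \<Gamma>"] by (auto simp: digraph_auts_def)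
    then show "digraph_auts \<Gamma> \<noteq> {}" by blast
  next
    fix f assume f: "f \<in> digraph_auts \<Gamma>"
    then have fB: "f \<in> Bij (pverts \<Gamma>)" by (auto simp: digraph_auts_def)
    define g where "g = (\<lambda>x\<in>pverts \<Gamma>. inv_into (pverts \<Gamma>) f x)"
    have gB: "g \<in> Bij (pverts \<Gamma>)" unfolding g_def using fB by (rule restrict_inv_into_Bij)
    have gf: "f (g x) = x" "g x \<in> pverts \<Gamma>" if "x \<in> pverts \<Gamma>" for x
      using that fB gB by (auto simp: g_def Bij_def bij_betw_def f_inv_into_f inv_into_into)
    have "g \<in> digraph_auts \<Gamma>"
      using f gB gf by (simp add: digraph_auts_def) metis
    then show "inv\<^bsub>BijGroup (pverts \<Gamma>)\<^esub> f \<in> digraph_auts \<Gamma>"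
      using inv_BijGroup[OF fB] by (simp add: g_def)
  next
    fix f g assume fg: "f \<in> digraph_auts \<Gamma>" "g \<in> digraph_auts \<Gamma>"
    then have B: "f \<in> Bij (pverts \<Gamma>)" "g \<in> Bij (pverts \<Gamma>)" by (auto simp: digraph_auts_def)
    have "x \<in> pverts \<Gamma> \<Longrightarrow> g x \<in> pverts \<Gamma>" for x
      using B by (auto simp: Bij_def bij_betw_def)
    then have "compose (pverts \<Gamma>) f g \<in> digraph_auts \<Gamma>"
      using fg compose_Bij[OF B] by (auto simp: digraph_auts_def compose_eq)
    then show "f \<otimes>\<^bsub>BijGroup (pverts \<Gamma>)\<^esub> g \<in> digraph_auts \<Gamma>"
      using B by (simp add: BijGroup_def)
  qed
qed

lemma group_digraph_aut_group: "group (digraph_aut_group \<Gamma>)"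
  unfolding digraph_aut_group_def
  by (rule group.subgroup_imp_group[OF group_BijGroup subgroup_digraph_auts])

lemma (in group) right_regular_subset_auts:
  assumes "connection_set G S"
  shows "right_regular G \<subseteq> digraph_auts (Cay G S)"
proof
  fix f assume "f \<in> right_regular G"
  then obtain g where g: "g \<in> carrier G" and f: "f = right_mult G g"
    by (auto simp: right_regular_def)
  have fx: "f x = x \<otimes> g" if "x \<in> carrier G" for x
    using that by (simp add: f right_mult_def)
  have "bij_betw f (carrier G) (carrier G)"
  proof (rule bij_betwI[of _ _ _ "\<lambda>x. x \<otimes> inv g"])
  qed (use g in \<open>auto simp: fx m_assoc\<close>)
  then have B: "f \<in> Bij (carrier G)"
    by (auto simp: Bij_def f right_mult_def)
  have Sc: "S \<subseteq> carrier G" using assms by (simp add: connection_set_def)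
  have "(f u, f v) \<in> parcs (Cay G S) \<longleftrightarrow> (u, v) \<in> parcs (Cay G S)"
    if uv: "u \<in> carrier G" "v \<in> carrier G" for u v
  proof -
    have "v \<otimes> g = s \<otimes> (u \<otimes> g) \<longleftrightarrow> v = s \<otimes> u" if "s \<in> S" for s
    proof -
      have s: "s \<in> carrier G" using that Sc by auto
      then have "s \<otimes> (u \<otimes> g) = (s \<otimes> u) \<otimes> g" using uv g by (simp add: m_assoc)
      then show ?thesis using s uv g by simp
    qed
    then show ?thesis using uv g by (auto simp: Cay_def fx)
  qed
  with B show "f \<in> digraph_auts (Cay G S)"
    by (simp add: digraph_auts_def) (simp add: Cay_def)
qed


section \<open>Group presentations and dihedral groups\<close>

text \<open>Words are lists of signed generators: \<open>(x, True)\<close> is the letter \<open>x\<close>, and \<open>(x, False)\<close> is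
  its formal inverse. A relation \<open>l = r\<close> is a pair of words \<open>(l, r)\<close>.\<close>

type_synonym 'x gword = "('x \<times> bool) list"

inductive pres_eq :: "('x gword \<times> 'x gword) set \<Rightarrow> 'x gword \<Rightarrow> 'x gword \<Rightarrow> bool" for R where
  pres_refl: "pres_eq R u u"
| pres_sym: "pres_eq R u v \<Longrightarrow> pres_eq R v u"
| pres_trans: "pres_eq R u v \<Longrightarrow> pres_eq R v w \<Longrightarrow> pres_eq R u w"
| pres_cancel: "pres_eq R (u @ [(x, e), (x, \<not> e)] @ v) (u @ v)"
| pres_rel: "(l, r) \<in> R \<Longrightarrow> pres_eq R (u @ l @ v) (u @ r @ v)"

definition pres_class :: "('x gword \<times> 'x gword) set \<Rightarrow> 'x gword \<Rightarrow> 'x gword set" where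
  "pres_class R u = {v. pres_eq R u v}"

definition presented_group :: "('x gword \<times> 'x gword) set \<Rightarrow> 'x gword set monoid" where
  "presented_group R =
     \<lparr>carrier = range (pres_class R),
      monoid.mult = (\<lambda>A B. \<Union>u\<in>A. \<Union>v\<in>B. pres_class R (u @ v)),
      one = pres_class R []\<rparr>"

datatype dihedral_gen = Gen_a | Gen_b

definition dihedral_rels :: "nat \<Rightarrow> (dihedral_gen gword \<times> dihedral_gen gword) set" where
  "dihedral_rels n =
     {(replicate n (Gen_a, True), []),
      (replicate 2 (Gen_b, True), []),
      ([(Gen_b, True), (Gen_a, True), (Gen_b, True)], [(Gen_a, False)])}"

definition dihedral_group :: "nat \<Rightarrow> dihedral_gen gword set monoid" where
  "dihedral_group n = presented_group (dihedral_rels n)"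

lemma pres_eq_ctx: "pres_eq R u v \<Longrightarrow> pres_eq R (p @ u @ q) (p @ v @ q)"
proof (induction rule: pres_eq.induct)
  case (pres_cancel u x e v)
  then show ?case using pres_eq.pres_cancel[of R "p @ u" x e "v @ q"] by simp
next
  case (pres_rel l r u v)
  then show ?case using pres_eq.pres_rel[of l r R "p @ u" "v @ q"] by simp
qed (blast intro: pres_eq.intros)+

lemma pres_eq_append: "pres_eq R u u' \<Longrightarrow> pres_eq R v v' \<Longrightarrow> pres_eq R (u @ v) (u' @ v')"
  using pres_eq_ctx[of R u u' "[]" v] pres_eq_ctx[of R v v' u' "[]"]
  by (auto intro: pres_trans)

lemma pres_class_eq_iff: "pres_class R u = pres_class R v \<longleftrightarrow> pres_eq R u v"
proof
  assume "pres_class R u = pres_class R v"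
  moreover have "v \<in> pres_class R v" by (simp add: pres_class_def pres_refl)
  ultimately show "pres_eq R u v" by (auto simp: pres_class_def)
next
  assume "pres_eq R u v"
  then show "pres_class R u = pres_class R v"
    by (auto simp: pres_class_def intro: pres_trans pres_sym)
qed

lemma presented_group_mult:
  "pres_class R u \<otimes>\<^bsub>presented_group R\<^esub> pres_class R v = pres_class R (u @ v)"
proof -
  have *: "pres_class R (u' @ v') = pres_class R (u @ v)"
    if "u' \<in> pres_class R u" "v' \<in> pres_class R v" for u' v'
    unfolding pres_class_eq_iff using that
    by (auto simp: pres_class_def intro: pres_eq_append pres_sym)
  have "u \<in> pres_class R u" "v \<in> pres_class R v"
    by (auto simp: pres_class_def intro: pres_refl)
  then have "(\<Union>u'\<in>pres_class R u. \<Union>v'\<in>pres_class R v. pres_class R (u' @ v')) = pres_class R (u @ v)"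
    using * by blast
  then show ?thesis by (simp add: presented_group_def)
qed

lemma presented_group_carrier: "carrier (presented_group R) = range (pres_class R)"
  by (simp add: presented_group_def)

lemma presented_group_one: "\<one>\<^bsub>presented_group R\<^esub> = pres_class R []"
  by (simp add: presented_group_def)

definition inv_word :: "'x gword \<Rightarrow> 'x gword" where
  "inv_word u = rev (map (\<lambda>(x, e). (x, \<not> e)) u)"

lemma pres_eq_inv_word: "pres_eq R (inv_word u @ u) []"
proof (induction u)
  case Nil
  then show ?case by (simp add: inv_word_def pres_refl)
next
  case (Cons p u)
  obtain x e where p: "p = (x, e)" by (cases p)
  have "pres_eq R (inv_word u @ [(x, \<not> e), (x, \<not> \<not> e)] @ u) (inv_word u @ u)"
    by (rule pres_cancel)
  then show ?case using Cons p by (auto simp: inv_word_def intro: pres_trans)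
qed

lemma group_presented_group: "group (presented_group R)"
proof (rule groupI)
  fix x assume "x \<in> carrier (presented_group R)"
  then obtain u where "x = pres_class R u" by (auto simp: presented_group_carrier)
  then show "\<exists>y\<in>carrier (presented_group R). y \<otimes>\<^bsub>presented_group R\<^esub> x = \<one>\<^bsub>presented_group R\<^esub>"
    by (intro bexI[of _ "pres_class R (inv_word u)"])
       (auto simp: presented_group_mult presented_group_one presented_group_carrier
          pres_class_eq_iff pres_eq_inv_word)
qed (auto simp: presented_group_carrier presented_group_mult presented_group_one)

text \<open>The presentation does define a group of order \<open>2 * n\<close>: every word equals exactly one
  \<open>a ^ k * b ^ e\<close>, with exponents computed by \<open>dih_val\<close>.\<close>

fun dih_val :: "nat \<Rightarrow> dihedral_gen gword \<Rightarrow> int \<times> bool" where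
  "dih_val n [] = (0, False)"
| "dih_val n ((Gen_a, s) # w) =
     (case dih_val n w of (k, e) \<Rightarrow> ((if s then k + 1 else k - 1) mod int n, e))"
| "dih_val n ((Gen_b, s) # w) = (case dih_val n w of (k, e) \<Rightarrow> ((- k) mod int n, \<not> e))"

definition dih_nf :: "int \<times> bool \<Rightarrow> dihedral_gen gword" where
  "dih_nf p = replicate (nat (fst p)) (Gen_a, True) @ (if snd p then [(Gen_b, True)] else [])"

lemma dih_val_range:
  assumes "n \<ge> 1"
  shows "fst (dih_val n w) \<in> {0..<int n}"
  using assms by (induction n w rule: dih_val.induct) (auto split: prod.splits)

lemma dih_val_append:
  "dih_val n v = dih_val n v' \<Longrightarrow> dih_val n (u @ v) = dih_val n (u @ v')"
proof (induction u)
  case (Cons p u)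
  then show ?case by (cases p; cases "fst p") auto
qed simp

lemma dih_val_pow:
  assumes "n \<ge> 1"
  shows "dih_val n (replicate k (Gen_a, True) @ v) =
    ((fst (dih_val n v) + int k) mod int n, snd (dih_val n v))"
  using dih_val_range[OF assms, of v]
  by (induction k) (auto simp: mod_simps algebra_simps split: prod.splits)

lemma dih_val_pres_eq:
  assumes "n \<ge> 1" "pres_eq (dihedral_rels n) u v"
  shows "dih_val n u = dih_val n v"
  using assms(2)
proof (induction rule: pres_eq.induct)
  case (pres_cancel u x e v)
  have "dih_val n ([(x, e), (x, \<not> e)] @ v) = dih_val n v"
    using dih_val_range[OF assms(1), of v]
    by (cases x) (auto simp: mod_simps split: prod.splits)
  then show ?case by (rule dih_val_append)
next
  case (pres_rel l r u v)
  have "dih_val n (l @ v) = dih_val n (r @ v)"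
    using pres_rel dih_val_range[OF assms(1), of v] dih_val_pow[OF assms(1), of n v]
    by (auto simp: dihedral_rels_def numeral_2_eq_2 mod_simps algebra_simps split: prod.splits)
  then show ?case by (rule dih_val_append)
qed auto

lemma dih_val_nf:
  assumes "n \<ge> 1" "fst p \<in> {0..<int n}"
  shows "dih_val n (dih_nf p) = p"
  using assms by (auto simp: dih_nf_def dih_val_pow prod_eq_iff dih_val_pow[OF assms(1), of _ "[]", simplified])

context
  fixes n :: nat
  assumes n1: "n \<ge> 1"
begin

private abbreviation pe (infix "\<doteq>" 50) where "pe \<equiv> pres_eq (dihedral_rels n)"

private lemma tr [trans]: "u \<doteq> v \<Longrightarrow> v \<doteq> w \<Longrightarrow> u \<doteq> w"
  by (rule pres_trans)

private lemma rel_a: "replicate n (Gen_a, True) @ v \<doteq> v"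
  using pres_rel[of "replicate n (Gen_a, True)" "[]" "dihedral_rels n" "[]" v]
  by (simp add: dihedral_rels_def)

private lemma rel_b: "(Gen_b, True) # (Gen_b, True) # v \<doteq> v"
  using pres_rel[of "replicate 2 (Gen_b, True)" "[]" "dihedral_rels n" "[]" v]
  by (simp add: dihedral_rels_def numeral_2_eq_2)

private lemma rel_bab: "(Gen_b, True) # (Gen_a, True) # (Gen_b, True) # v \<doteq> (Gen_a, False) # v"
  using pres_rel[of "[(Gen_b, True), (Gen_a, True), (Gen_b, True)]" "[(Gen_a, False)]"
      "dihedral_rels n" "[]" v]
  by (simp add: dihedral_rels_def)

private lemma canc: "(x, e) # (x, \<not> e) # v \<doteq> v"
  using pres_cancel[of "dihedral_rels n" "[]" x e v] by simp

private lemma cons: "u \<doteq> v \<Longrightarrow> p # u \<doteq> p # v"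
  using pres_eq_ctx[of "dihedral_rels n" u v "[p]" "[]"] by simp

private lemma nf_a:
  assumes k: "0 \<le> k" "k < int n"
  shows "(Gen_a, True) # dih_nf (k, e) \<doteq> dih_nf ((k + 1) mod int n, e)"
proof (cases "k + 1 = int n")
  case True
  then have "Suc (nat k) = n" using k by linarith
  then have "(Gen_a, True) # dih_nf (k, e) = replicate n (Gen_a, True) @ dih_nf (0, e)"
    by (auto simp: dih_nf_def)
  with True show ?thesis using rel_a[of "dih_nf (0, e)"] by simp
next
  case False
  then have "dih_nf ((k + 1) mod int n, e) = (Gen_a, True) # dih_nf (k, e)"
    using k by (simp add: dih_nf_def nat_add_distrib)
  then show ?thesis by (simp add: pres_refl)
qed

private lemma nf_a':
  assumes k: "0 \<le> k" "k < int n"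
  shows "(Gen_a, False) # dih_nf (k, e) \<doteq> dih_nf ((k - 1) mod int n, e)"
proof -
  define j where "j = (k - 1) mod int n"
  have j: "0 \<le> j" "j < int n" using n1 by (auto simp: j_def)
  have "(j + 1) mod int n = k" using k by (simp add: j_def mod_simps)
  with nf_a[OF j, of e] have "dih_nf (k, e) \<doteq> (Gen_a, True) # dih_nf (j, e)"
    by (auto intro: pres_sym)
  then have "(Gen_a, False) # dih_nf (k, e) \<doteq> (Gen_a, False) # (Gen_a, \<not> False) # dih_nf (j, e)"
    by (auto dest: cons)
  also have "\<dots> \<doteq> dih_nf (j, e)" by (rule canc)
  finally show ?thesis by (simp add: j_def)
qed

private lemma ba: "(Gen_b, True) # (Gen_a, True) # v \<doteq> (Gen_a, False) # (Gen_b, True) # v"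
proof -
  have "(Gen_b, True) # (Gen_a, True) # v \<doteq>
      (Gen_b, True) # (Gen_a, True) # (Gen_b, True) # (Gen_b, True) # v"
    by (intro cons pres_sym[OF rel_b])
  also have "\<dots> \<doteq> (Gen_a, False) # (Gen_b, True) # v" by (rule rel_bab)
  finally show ?thesis .
qed

private lemma nf_b_aux:
  "(Gen_b, True) # replicate k (Gen_a, True) @ (if e then [(Gen_b, True)] else []) \<doteq>
     dih_nf ((- int k) mod int n, \<not> e)"
proof (induction k)
  case 0
  then show ?case using rel_b[of "[]"] by (auto simp: dih_nf_def pres_refl)
next
  case (Suc k)
  have "(Gen_b, True) # replicate (Suc k) (Gen_a, True) @ (if e then [(Gen_b, True)] else []) \<doteq>
      (Gen_a, False) # (Gen_b, True) # replicate k (Gen_a, True) @ (if e then [(Gen_b, True)] else [])"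
    using ba by simp
  also have "\<dots> \<doteq> (Gen_a, False) # dih_nf ((- int k) mod int n, \<not> e)"
    by (rule cons[OF Suc])
  also have "\<dots> \<doteq> dih_nf (((- int k) mod int n - 1) mod int n, \<not> e)"
    using n1 by (intro nf_a') auto
  also have "((- int k) mod int n - 1) mod int n = (- int (Suc k)) mod int n"
    by (simp add: mod_diff_left_eq) (rule arg_cong[where f = "\<lambda>x. x mod int n"], simp)
  finally show ?case .
qed

private lemma b_inv: "(Gen_b, False) # v \<doteq> (Gen_b, True) # v"
proof -
  have "(Gen_b, False) # v \<doteq> (Gen_b, False) # (Gen_b, \<not> False) # (Gen_b, True) # v"
    using cons[OF pres_sym[OF rel_b]] by simp
  also have "\<dots> \<doteq> (Gen_b, True) # v" by (rule canc)
  finally show ?thesis .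
qed

lemma pres_eq_dih_nf: "pres_eq (dihedral_rels n) w (dih_nf (dih_val n w))"
proof (induction w)
  case Nil
  then show ?case by (simp add: dih_nf_def pres_refl)
next
  case (Cons p w)
  obtain k e where ke: "dih_val n w = (k, e)" by (cases "dih_val n w")
  have k: "0 \<le> k" "k < int n" using dih_val_range[OF n1, of w] ke by auto
  have *: "p # w \<doteq> p # dih_nf (k, e)" using cons[OF Cons] ke by simp
  have b: "(Gen_b, True) # dih_nf (k, e) \<doteq> dih_nf ((- k) mod int n, \<not> e)"
    using nf_b_aux[of "nat k" e] k by (simp add: dih_nf_def)
  have "p # dih_nf (k, e) \<doteq> dih_nf (dih_val n (p # w))"
  proof (cases p)
    case (Pair x s)
    then show ?thesis
      using ke nf_a[OF k, of e] nf_a'[OF k, of e] b tr[OF b_inv b]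
      by (cases x; cases s) auto
  qed
  then show ?case by (rule tr[OF *])
qed

lemma pres_eq_dihedral_iff: "pres_eq (dihedral_rels n) u v \<longleftrightarrow> dih_val n u = dih_val n v"
  using dih_val_pres_eq[OF n1] pres_eq_dih_nf[of u] pres_eq_dih_nf[of v]
  by (metis pres_sym pres_trans)

lemma order_dihedral_group: "order (dihedral_group n) = 2 * n"
proof -
  let ?C = "pres_class (dihedral_rels n)"
  let ?N = "{0..<int n} \<times> (UNIV :: bool set)"
  have "bij_betw (?C \<circ> dih_nf) ?N (range ?C)"
    unfolding bij_betw_def
  proof (intro conjI inj_onI)
    fix p q assume "p \<in> ?N" "q \<in> ?N" "(?C \<circ> dih_nf) p = (?C \<circ> dih_nf) q"
    then show "p = q"
      using dih_val_nf[OF n1, of p] dih_val_nf[OF n1, of q]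
      by (auto simp: pres_class_eq_iff pres_eq_dihedral_iff)
  next
    have "?C u \<in> (?C \<circ> dih_nf) ` ?N" for u
      using dih_val_range[OF n1, of u] pres_eq_dih_nf[of u]
      by (intro image_eqI[of _ _ "dih_val n u"])
         (auto simp: pres_class_eq_iff mem_Times_iff)
    then show "(?C \<circ> dih_nf) ` ?N = range ?C" by auto
  qed
  then have "card (range ?C) = card ?N" by (simp add: bij_betw_same_card)
  then show ?thesis
    by (simp add: order_def dihedral_group_def presented_group_carrier card_cartesian_product)
qed

end

end

theory Submission
  imports Defs "HOL-Number_Theory.Cong" "HOL-Combinatorics.Transposition"
begin

text \<open>
  For \<open>n \<ge> 3\<close> the normalizer of the right regular representation of \<open>D\<^sub>2\<^sub>n\<close> consists of the maps
  \<open>a\<^sup>i b\<^sup>e \<mapsto> a\<^bsup>r i + c(e)\<^esup> b\<^bsup>e + \<epsilon>\<^esup>\<close>. An isomorphism from a normal Cayley digraph conjugates the right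
  regular representation to another regular dihedral group of such maps. If it is a different one,
  the maps it contains force periodicities of the connection set, and these allow automorphisms that
  are not of the above form: multiplying only the rotations by some \<open>r\<close>, or translating by
  \<open>n / p\<close> on single classes modulo a prime \<open>p\<close>. For \<open>n = 4\<close> what remains is a few graphs on eight
  vertices. So for odd \<open>n\<close> and \<open>n = 4\<close> the isomorphism normalizes the right regular representation
  and yields a group automorphism; for \<open>n = 2\<close> every bijection does. Conversely, for even
  \<open>n \<ge> 6\<close> the prism with connection set \<open>{a, a\<^sup>-\<^sup>1, b}\<close> is normal but isomorphic to the
  Cayley graph of \<open>{b, ab, a\<^sup>2b}\<close>.
\<close>

section \<open>Normality and the CI property for Cayley digraphs\<close>

text \<open>The isomorphism \<open>f\<close> is an arbitrary bijection, so the only handle on it is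
  the group of maps \<open>conj_mult g\<close>: right multiplications of the target, pulled back
  along \<open>f\<close>. They act regularly on the vertices and are automorphisms of the source,
  hence affine by normality. Parity governs how they can differ from right multiplications: a map of
  odd order cannot exchange rotations and reflections, whereas for even \<open>n\<close> the
  rotation \<open>a\<close> may be carried to an exchanging map, as happens in the prism. For odd
  \<open>n\<close> the slope \<open>r\<close> of the image of \<open>a\<close> is the remaining
  obstacle. It is 1 modulo every prime divisor of \<open>n\<close>; if it is not 1 modulo
  \<open>n\<close>, a suitable power of it is \<open>1 + \<pi> * u\<close> with
  \<open>\<pi> = n / p\<close> and \<open>p\<close> not dividing \<open>u\<close>, which is where
  the shift by \<open>\<pi>\<close> comes from. Affine coordinates start at \<open>n = 3\<close>,
  because automorphisms of the Klein group need not preserve the rotations; the prism serves beyond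
  4, because over a 4-cycle it is a cube, whose rungs cannot be recognised. The positive half is
  proved for digraphs while the counterexample is an undirected graph, and this closes the circle of
  equivalences.\<close>

lemma Cay_simps [simp]:
  "pverts (Cay G S) = carrier G"
  "parcs (Cay G S) = {(g, s \<otimes>\<^bsub>G\<^esub> g) | g s. g \<in> carrier G \<and> s \<in> S}"
  by (simp_all add: Cay_def)

context group
begin

lemma arc_Cay_iff:
  assumes "S \<subseteq> carrier G" "u \<in> carrier G" "v \<in> carrier G"
  shows "(u, v) \<in> parcs (Cay G S) \<longleftrightarrow> v \<otimes> inv u \<in> S"
proof
  assume "(u, v) \<in> parcs (Cay G S)"
  then obtain s where "s \<in> S" "v = s \<otimes> u" by auto
  then show "v \<otimes> inv u \<in> S" using assms by (auto simp: m_assoc)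
next
  assume "v \<otimes> inv u \<in> S"
  moreover have "v = (v \<otimes> inv u) \<otimes> u" using assms by (simp add: m_assoc)
  ultimately show "(u, v) \<in> parcs (Cay G S)" using assms(2) by auto
qed

lemma right_mult_apply: "u \<in> carrier G \<Longrightarrow> right_mult G g u = u \<otimes> g"
  by (simp add: right_mult_def)

lemma subgroup_right_regular:
  assumes "connection_set G S"
  shows "subgroup (right_regular G) (digraph_aut_group (Cay G S))"
proof -
  let ?A = "digraph_aut_group (Cay G S)"
  interpret A: group ?A by (rule group_digraph_aut_group)
  have sub: "right_regular G \<subseteq> carrier ?A"
    using right_regular_subset_auts[OF assms] by (simp add: digraph_aut_group_def)
  have Bij: "right_mult G x \<in> Bij (carrier G)" if "x \<in> carrier G" for x
    using right_regular_subset_auts[OF assms] that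
    by (auto simp: right_regular_def digraph_auts_def)
  have mult: "right_mult G x \<otimes>\<^bsub>?A\<^esub> right_mult G y = right_mult G (y \<otimes> x)"
    if "x \<in> carrier G" "y \<in> carrier G" for x y
    using that Bij
    by (auto simp: digraph_aut_group_def BijGroup_def right_mult_def compose_def m_assoc
        intro!: restrict_ext)
  have one: "right_mult G \<one> = \<one>\<^bsub>?A\<^esub>"
    by (auto simp: digraph_aut_group_def BijGroup_def right_mult_def intro!: restrict_ext)
  show ?thesis
  proof (rule A.subgroupI[OF sub])
    show "right_regular G \<noteq> {}" by (auto simp: right_regular_def)
  next
    fix p assume "p \<in> right_regular G"
    then obtain x where x: "x \<in> carrier G" "p = right_mult G x" by (auto simp: right_regular_def)
    then have "inv\<^bsub>?A\<^esub> p = right_mult G (inv x)"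
      using sub by (intro A.inv_equality) (auto simp: mult one right_regular_def)
    then show "inv\<^bsub>?A\<^esub> p \<in> right_regular G" using x by (simp add: right_regular_def)
  next
    fix p q assume "p \<in> right_regular G" "q \<in> right_regular G"
    then show "p \<otimes>\<^bsub>?A\<^esub> q \<in> right_regular G" by (auto simp: right_regular_def mult)
  qed
qed

text \<open>Conjugating \<open>right_mult G y\<close> by an automorphism \<open>f\<close> must give
  some \<open>right_mult G z\<close>, and evaluation at \<open>\<one>\<close> leaves only
  \<open>z = inv (f \<one>) \<otimes> f y\<close>. Normality thus becomes an identity between
  values, the form in which it is used and verified from here on.\<close>

lemma normal_Cay_iff:
  assumes S: "connection_set G S"
  shows "normal_Cay G S \<longleftrightarrow> (\<forall>f\<in>digraph_auts (Cay G S).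
     \<forall>x\<in>carrier G. \<forall>y\<in>carrier G. f (x \<otimes> y) = f x \<otimes> inv (f \<one>) \<otimes> f y)"
proof -
  let ?A = "digraph_aut_group (Cay G S)"
  interpret A: group ?A by (rule group_digraph_aut_group)
  have sub: "right_regular G \<subseteq> carrier ?A"
    using right_regular_subset_auts[OF S] by (simp add: digraph_aut_group_def)
  have car: "carrier ?A = digraph_auts (Cay G S)" by (simp add: digraph_aut_group_def)
  have closed: "f x \<in> carrier G" if "f \<in> digraph_auts (Cay G S)" "x \<in> carrier G" for f x
    using that by (auto simp: digraph_auts_def Bij_def bij_betw_def)
  have mult: "(f \<otimes>\<^bsub>?A\<^esub> g) x = f (g x)" if "f \<in> carrier ?A" "g \<in> carrier ?A" "x \<in> carrier G" for f g x
    using that by (auto simp: digraph_aut_group_def digraph_auts_def BijGroup_def compose_def)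
  have R: "right_mult G x \<in> carrier ?A" if "x \<in> carrier G" for x
    using that sub by (auto simp: right_regular_def)
  have ext: "f \<otimes>\<^bsub>?A\<^esub> right_mult G y = right_mult G z \<otimes>\<^bsub>?A\<^esub> f \<longleftrightarrow>
      (\<forall>x\<in>carrier G. f (x \<otimes> y) = f x \<otimes> z)"
    if f: "f \<in> carrier ?A" and y: "y \<in> carrier G" and z: "z \<in> carrier G" for f y z
  proof
    assume e: "f \<otimes>\<^bsub>?A\<^esub> right_mult G y = right_mult G z \<otimes>\<^bsub>?A\<^esub> f"
    show "\<forall>x\<in>carrier G. f (x \<otimes> y) = f x \<otimes> z"
    proof
      fix x assume x: "x \<in> carrier G"
      show "f (x \<otimes> y) = f x \<otimes> z"
        using fun_cong[OF e, of x] f y z x R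
        by (simp add: mult right_mult_apply closed[OF _ x] car)
    qed
  next
    assume e: "\<forall>x\<in>carrier G. f (x \<otimes> y) = f x \<otimes> z"
    show "f \<otimes>\<^bsub>?A\<^esub> right_mult G y = right_mult G z \<otimes>\<^bsub>?A\<^esub> f"
    proof (rule extensionalityI[of _ "carrier G"])
      show "f \<otimes>\<^bsub>?A\<^esub> right_mult G y \<in> extensional (carrier G)"
        using A.m_closed[OF f R[OF y]] by (auto simp: car digraph_auts_def Bij_def)
      show "right_mult G z \<otimes>\<^bsub>?A\<^esub> f \<in> extensional (carrier G)"
        using A.m_closed[OF R[OF z] f] by (auto simp: car digraph_auts_def Bij_def)
    qed (use f y z R e in \<open>simp add: mult right_mult_apply closed car\<close>)
  qed
  show ?thesis
  proof
    assume N: "normal_Cay G S"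
    show "\<forall>f\<in>digraph_auts (Cay G S).
      \<forall>x\<in>carrier G. \<forall>y\<in>carrier G. f (x \<otimes> y) = f x \<otimes> inv (f \<one>) \<otimes> f y"
    proof (intro ballI)
      fix f x y assume f: "f \<in> digraph_auts (Cay G S)" and x: "x \<in> carrier G" and y: "y \<in> carrier G"
      have f': "f \<in> carrier ?A" using f car by simp
      have "f \<otimes>\<^bsub>?A\<^esub> right_mult G y \<otimes>\<^bsub>?A\<^esub> inv\<^bsub>?A\<^esub> f \<in> right_regular G"
        using N f' y unfolding normal_Cay_def by (auto simp: A.normal_inv_iff right_regular_def)
      then obtain z where z: "z \<in> carrier G"
        "f \<otimes>\<^bsub>?A\<^esub> right_mult G y \<otimes>\<^bsub>?A\<^esub> inv\<^bsub>?A\<^esub> f = right_mult G z"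
        by (auto simp: right_regular_def)
      then have "f \<otimes>\<^bsub>?A\<^esub> right_mult G y = right_mult G z \<otimes>\<^bsub>?A\<^esub> f"
        using f' R y by (metis A.inv_solve_right' A.m_closed)
      then have e: "f (u \<otimes> y) = f u \<otimes> z" if "u \<in> carrier G" for u
        using ext[OF f' y z(1)] that by blast
      have "f y = f \<one> \<otimes> z" using e[of \<one>] y by simp
      then have "z = inv (f \<one>) \<otimes> f y"
        using z(1) closed[OF f] by (simp add: m_assoc[symmetric])
      then show "f (x \<otimes> y) = f x \<otimes> inv (f \<one>) \<otimes> f y"
        using e[OF x] closed[OF f] x y by (simp add: m_assoc)
    qed
  next
    assume H: "\<forall>f\<in>digraph_auts (Cay G S).
      \<forall>x\<in>carrier G. \<forall>y\<in>carrier G. f (x \<otimes> y) = f x \<otimes> inv (f \<one>) \<otimes> f y"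
    show "normal_Cay G S"
      unfolding normal_Cay_def
    proof (rule A.normal_invI[OF subgroup_right_regular[OF S]])
      fix f p assume f: "f \<in> carrier ?A" and p: "p \<in> right_regular G"
      obtain y where y: "y \<in> carrier G" "p = right_mult G y" using p by (auto simp: right_regular_def)
      have fa: "f \<in> digraph_auts (Cay G S)" using f car by simp
      define z where "z = inv (f \<one>) \<otimes> f y"
      have z: "z \<in> carrier G" using closed[OF fa] y by (simp add: z_def)
      have "f (x \<otimes> y) = f x \<otimes> z" if "x \<in> carrier G" for x
      proof -
        have "f (x \<otimes> y) = f x \<otimes> inv (f \<one>) \<otimes> f y" using H fa y(1) that by blast
        then show ?thesis using closed[OF fa] that y(1) by (simp add: z_def m_assoc)
      qed
      then have "f \<otimes>\<^bsub>?A\<^esub> right_mult G y = right_mult G z \<otimes>\<^bsub>?A\<^esub> f"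
        using ext[OF f y(1) z] by blast
      then have "f \<otimes>\<^bsub>?A\<^esub> p \<otimes>\<^bsub>?A\<^esub> inv\<^bsub>?A\<^esub> f = right_mult G z"
        using f R[OF z] R[OF y(1)] y(2) by (metis A.inv_solve_right' A.m_closed)
      then show "f \<otimes>\<^bsub>?A\<^esub> p \<otimes>\<^bsub>?A\<^esub> inv\<^bsub>?A\<^esub> f \<in> right_regular G"
        using z by (simp add: right_regular_def)
    qed
  qed
qed

text \<open>Right multiplication by \<open>inv (f \<one>)\<close> brings \<open>f \<one>\<close>
  back to the identity and turns \<open>f\<close> into a homomorphism. An arc from
  \<open>\<one>\<close> to \<open>x\<close> records whether \<open>x\<close> lies in
  \<open>S\<close>; its image records whether \<open>\<alpha> x\<close> lies in
  \<open>T\<close>.\<close>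

lemma affine_iso_imp_auto:
  assumes S: "connection_set G S" and T: "connection_set G T"
    and bij: "bij_betw f (carrier G) (carrier G)"
    and arcs: "\<And>u v. u \<in> carrier G \<Longrightarrow> v \<in> carrier G \<Longrightarrow>
      (u, v) \<in> parcs (Cay G S) \<longleftrightarrow> (f u, f v) \<in> parcs (Cay G T)"
    and affine: "\<And>x y. x \<in> carrier G \<Longrightarrow> y \<in> carrier G \<Longrightarrow> f (x \<otimes> y) = f x \<otimes> inv (f \<one>) \<otimes> f y"
  shows "\<exists>\<alpha>\<in>auto G. \<alpha> ` S = T"
proof -
  have ST: "S \<subseteq> carrier G" "T \<subseteq> carrier G" using S T by (auto simp: connection_set_def)
  have closed [simp]: "x \<in> carrier G \<Longrightarrow> f x \<in> carrier G" for x
    using bij by (auto simp: bij_betw_def)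
  define \<alpha> where "\<alpha> = (\<lambda>x\<in>carrier G. f x \<otimes> inv (f \<one>))"
  have "bij_betw ((\<lambda>x. x \<otimes> inv (f \<one>)) \<circ> f) (carrier G) (carrier G)"
    by (intro bij_betw_trans[OF bij] bij_betwI[of _ _ _ "\<lambda>x. x \<otimes> f \<one>"]) (auto simp: m_assoc)
  then have "bij_betw \<alpha> (carrier G) (carrier G)"
    by (rule bij_betw_cong[THEN iffD1, rotated]) (simp add: \<alpha>_def)
  moreover have "\<alpha> \<in> hom G G"
    by (auto simp: hom_def \<alpha>_def affine m_assoc)
  ultimately have "\<alpha> \<in> auto G" by (simp add: auto_def Bij_def \<alpha>_def)
  have mem: "x \<in> S \<longleftrightarrow> \<alpha> x \<in> T" if "x \<in> carrier G" for x
    using arcs[of \<one> x] arc_Cay_iff[OF ST(1), of \<one> x] arc_Cay_iff[OF ST(2), of "f \<one>" "f x"] that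
    by (simp add: \<alpha>_def del: Cay_simps)
  have "\<alpha> ` S = T"
  proof
    show "\<alpha> ` S \<subseteq> T" using mem ST by auto
    show "T \<subseteq> \<alpha> ` S"
    proof
      fix t assume t: "t \<in> T"
      then have "t \<in> \<alpha> ` carrier G"
        using ST \<open>bij_betw \<alpha> _ _\<close> by (auto simp: bij_betw_def)
      then obtain x where "x \<in> carrier G" "t = \<alpha> x" by blast
      then show "t \<in> \<alpha> ` S" using mem t by auto
    qed
  qed
  with \<open>\<alpha> \<in> auto G\<close> show ?thesis by blast
qed

text \<open>Take for \<open>g\<close> the translation from \<open>f \<one>\<close> to
  \<open>f y\<close>. By injectivity of \<open>f\<close>, the matching translation of the source can
  only be the one by \<open>y\<close>.\<close>

lemma conjugate_regular_imp_affine: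
  assumes bij: "bij_betw f (carrier G) (carrier G)"
    and conj: "\<And>g. g \<in> carrier G \<Longrightarrow> \<exists>x\<in>carrier G. \<forall>u\<in>carrier G. f (u \<otimes> x) = f u \<otimes> g"
    and x: "x \<in> carrier G" and y: "y \<in> carrier G"
  shows "f (x \<otimes> y) = f x \<otimes> inv (f \<one>) \<otimes> f y"
proof -
  have closed [simp]: "x \<in> carrier G \<Longrightarrow> f x \<in> carrier G" for x
    using bij by (auto simp: bij_betw_def)
  obtain z where z: "z \<in> carrier G"
    and e: "\<And>u. u \<in> carrier G \<Longrightarrow> f (u \<otimes> z) = f u \<otimes> (inv (f \<one>) \<otimes> f y)"
    using conj[of "inv (f \<one>) \<otimes> f y"] y by auto
  have "f z = f y" using e[of \<one>] z y by (simp add: m_assoc[symmetric])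
  then have "z = y" using bij z y by (auto simp: bij_betw_def dest: inj_onD)
  then show ?thesis using e[OF x] x y by (simp add: m_assoc)
qed

end

section \<open>Dihedral coordinates\<close>

text \<open>\<open>el i e\<close> is the element \<open>a\<^sup>i b\<^sup>e\<close>.\<close>

locale dihedral_coords = group G for G (structure) +
  fixes n :: nat and el :: "int \<Rightarrow> bool \<Rightarrow> 'a"
  assumes n_ge_2: "2 \<le> n"
    and carrier_el: "carrier G = {el i e | i e. True}"
    and el_eq_iff: "el i e = el j e' \<longleftrightarrow> [i = j] (mod int n) \<and> e = e'"
    and el_mult: "el i e \<otimes> el j e' = el (if e then i - j else i + j) (e \<noteq> e')"
begin

lemma el_closed [simp, intro]: "el i e \<in> carrier G"
  by (auto simp: carrier_el)

lemma el_cases: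
  assumes "x \<in> carrier G"
  obtains i e where "x = el i e"
  using assms by (auto simp: carrier_el)

lemma el_cases_range:
  assumes "x \<in> carrier G"
  obtains i e where "x = el i e" "0 \<le> i" "i < int n"
proof -
  obtain i e where "x = el i e" using assms by (rule el_cases)
  then have "x = el (i mod int n) e" by (simp add: el_eq_iff cong_def)
  then show ?thesis using n_ge_2 by (intro that[of "i mod int n" e]) auto
qed

lemma one_el: "\<one> = el 0 False"
proof -
  have "el 0 False \<otimes> el 0 False = el 0 False" by (simp add: el_mult)
  then show ?thesis using r_cancel_one'[of "el 0 False" "el 0 False"] by simp
qed

lemma inv_el: "inv (el i e) = el (if e then i else - i) e"
  by (rule inv_equality) (auto simp: el_mult one_el)

lemma finite_carrier: "finite (carrier G)"
proof (rule finite_subset)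
  show "carrier G \<subseteq> case_prod el ` ({0..<int n} \<times> UNIV)"
    by (auto elim!: el_cases_range)
qed simp

lemma el_cong: "[i = j] (mod int n) \<Longrightarrow> el i e = el j e"
  by (simp add: el_eq_iff)

text \<open>The quotient of a rotation and a reflection, in either order, is the reflection whose
  exponent is the sum. So equal shifts preserve arcs inside a coset, and opposite shifts preserve
  arcs between the two cosets.\<close>

lemma arc_el_iff:
  assumes "S \<subseteq> carrier G"
  shows "(el i e, el j e') \<in> parcs (Cay G S) \<longleftrightarrow>
    (if e = e' then el (j - i) False \<in> S else el (i + j) True \<in> S)"
  using arc_Cay_iff[OF assms, of "el i e" "el j e'"]
  by (auto simp: inv_el el_mult add.commute simp del: Cay_simps)

text \<open>Coordinate form of the elements of the normalizer; \<open>\<epsilon>\<close> tells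
  whether rotations and reflections are exchanged. Right multiplications are the maps with
  \<open>r = 1\<close> and \<open>c True = - c False\<close> modulo \<open>n\<close>, so these two
  relations are what has to be established for the transported generators.\<close>

definition affine :: "int \<Rightarrow> (bool \<Rightarrow> int) \<Rightarrow> bool \<Rightarrow> ('a \<Rightarrow> 'a) \<Rightarrow> bool" where
  "affine r c \<epsilon> f \<longleftrightarrow> (\<forall>i e. f (el i e) = el (r * i + c e) (e \<noteq> \<epsilon>))"

lemma affineD: "affine r c \<epsilon> f \<Longrightarrow> f (el i e) = el (r * i + c e) (e \<noteq> \<epsilon>)"
  by (simp add: affine_def)

text \<open>\<open>\<alpha> x = inv (f \<one>) \<otimes> f x\<close> is a group automorphism. It
  keeps \<open>a\<close> a rotation, since \<open>a\<close> is not an involution, and surjectivity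
  then keeps \<open>b\<close> a reflection. Left multiplication by \<open>f \<one>\<close> adds an
  offset and, if \<open>f \<one>\<close> is a reflection, reverses all signs.\<close>

lemma translate_imp_affine:
  assumes n: "n \<ge> 3"
    and bij: "bij_betw f (carrier G) (carrier G)"
    and hom: "\<And>x y. x \<in> carrier G \<Longrightarrow> y \<in> carrier G \<Longrightarrow> f (x \<otimes> y) = f x \<otimes> inv (f \<one>) \<otimes> f y"
  obtains r c \<epsilon> where "affine r c \<epsilon> f"
proof -
  have closed [simp]: "f x \<in> carrier G" if "x \<in> carrier G" for x
    using that bij by (auto simp: bij_betw_def)
  have inj: "x = y" if "f x = f y" "x \<in> carrier G" "y \<in> carrier G" for x y
    using that bij by (auto simp: bij_betw_def dest: inj_onD)
  define \<alpha> where "\<alpha> x = inv (f \<one>) \<otimes> f x" for x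
  have \<alpha>_closed [simp]: "\<alpha> x \<in> carrier G" if "x \<in> carrier G" for x
    using that by (simp add: \<alpha>_def)
  have f\<alpha>: "f x = f \<one> \<otimes> \<alpha> x" if "x \<in> carrier G" for x
    using that by (simp add: \<alpha>_def m_assoc[symmetric])
  have \<alpha>_inj: "x = y" if "\<alpha> x = \<alpha> y" "x \<in> carrier G" "y \<in> carrier G" for x y
    using that inj[of x y] by (simp add: \<alpha>_def)
  have \<alpha>_mult: "\<alpha> (x \<otimes> y) = \<alpha> x \<otimes> \<alpha> y" if "x \<in> carrier G" "y \<in> carrier G" for x y
    using that by (simp add: \<alpha>_def hom m_assoc)
  have \<alpha>_one: "\<alpha> \<one> = \<one>" by (simp add: \<alpha>_def)
  obtain r e1 where r: "\<alpha> (el 1 False) = el r e1" by (meson \<alpha>_closed el_cases el_closed)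
  have "\<not> e1"
  proof
    assume e1
    then have "\<alpha> (el 2 False) = \<alpha> \<one>"
      using \<alpha>_mult[of "el 1 False" "el 1 False"] r \<alpha>_one by (simp add: el_mult one_el)
    then have "el 2 False = el 0 False" using \<alpha>_inj[of "el 2 False" \<one>] one_el by simp
    then have "int n dvd 2" by (simp add: el_eq_iff cong_0_iff)
    then show False using n by (auto dest: zdvd_imp_le)
  qed
  then have r: "\<alpha> (el 1 False) = el r False" using r by simp
  have rot: "\<alpha> (el i False) = el (r * i) False" for i
  proof -
    have "\<alpha> (el (int k) False) = el (r * int k) False" for k
    proof (induction k)
      case 0
      then show ?case using \<alpha>_one by (simp add: one_el)
    next
      case (Suc k)
      have "el (int (Suc k)) False = el (int k) False \<otimes> el 1 False" by (simp add: el_mult add.commute)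
      then show ?case using \<alpha>_mult[of "el (int k) False" "el 1 False"] Suc r
        by (simp add: el_mult distrib_left add.commute)
    qed
    from this[of "nat (i mod int n)"] have "\<alpha> (el (i mod int n) False) = el (r * (i mod int n)) False"
      using n_ge_2 by simp
    moreover have "el (i mod int n) False = el i False" by (simp add: el_eq_iff cong_def)
    moreover have "el (r * (i mod int n)) False = el (r * i) False"
      by (simp add: el_eq_iff cong_def mod_simps)
    ultimately show ?thesis by simp
  qed
  obtain s e2 where s: "\<alpha> (el 0 True) = el s e2" by (meson \<alpha>_closed el_cases el_closed)
  have refl: "\<alpha> (el i True) = el (r * i + s) e2" for i
    using \<alpha>_mult[of "el i False" "el 0 True"] s rot by (simp add: el_mult)
  have e2
  proof (rule ccontr)
    assume "\<not> e2"
    have "f \<one> \<otimes> el 0 True \<in> f ` carrier G" using bij by (auto simp: bij_betw_def)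
    then obtain x where x: "x \<in> carrier G" "f x = f \<one> \<otimes> el 0 True" by auto
    then have "\<alpha> x = el 0 True" by (simp add: \<alpha>_def m_assoc[symmetric])
    moreover obtain i e where "x = el i e" using x(1) by (rule el_cases)
    ultimately show False using rot[of i] refl[of i] \<open>\<not> e2\<close> by (cases e) (auto simp: el_eq_iff)
  qed
  have \<alpha>: "\<alpha> (el i e) = el (r * i + (if e then s else 0)) e" for i e
    using rot[of i] refl[of i] \<open>e2\<close> by (cases e) auto
  obtain d \<epsilon> where d: "f \<one> = el d \<epsilon>" by (meson closed el_cases one_closed)
  have "affine (if \<epsilon> then - r else r) (\<lambda>e. if \<epsilon> then d - (if e then s else 0) else d + (if e then s else 0)) \<epsilon> f"
    unfolding affine_def
  proof (intro allI)
    fix i e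
    show "f (el i e) = el ((if \<epsilon> then - r else r) * i +
        (if \<epsilon> then d - (if e then s else 0) else d + (if e then s else 0))) (e \<noteq> \<epsilon>)"
      using f\<alpha>[of "el i e"] by (cases \<epsilon>) (simp_all add: d \<alpha> el_mult algebra_simps)
  qed
  then show ?thesis by (rule that)
qed

lemma normal_Cay_affine:
  assumes "n \<ge> 3" "connection_set G S" "normal_Cay G S" "f \<in> digraph_auts (Cay G S)"
  obtains r c \<epsilon> where "affine r c \<epsilon> f"
proof (rule translate_imp_affine[OF assms(1)])
  show "bij_betw f (carrier G) (carrier G)"
    using assms(4) by (simp add: digraph_auts_def Bij_def)
  show "f (x \<otimes> y) = f x \<otimes> inv (f \<one>) \<otimes> f y" if "x \<in> carrier G" "y \<in> carrier G" for x y
    using assms(3,4) that by (simp add: normal_Cay_iff[OF assms(2)])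
qed

text \<open>Compare the arcs leaving \<open>el 0 False\<close>: inside a coset the offsets cancel,
  between cosets they add up. For a right multiplication the sum \<open>c False + c True\<close>
  vanishes modulo \<open>n\<close>.\<close>

lemma affine_aut_invariant:
  assumes S: "S \<subseteq> carrier G" and f: "f \<in> digraph_auts (Cay G S)" and a: "affine r c \<epsilon> f"
  shows "el (r * x) False \<in> S \<longleftrightarrow> el x False \<in> S"
    and "el (r * x + (c False + c True)) True \<in> S \<longleftrightarrow> el x True \<in> S"
proof -
  have A: "(f u, f v) \<in> parcs (Cay G S) \<longleftrightarrow> (u, v) \<in> parcs (Cay G S)"
    if "u \<in> carrier G" "v \<in> carrier G" for u v
    using f that by (simp add: digraph_auts_def)
  show "el (r * x) False \<in> S \<longleftrightarrow> el x False \<in> S"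
    using A[of "el 0 False" "el x False"] affineD[OF a]
    by (simp add: arc_el_iff[OF S] del: Cay_simps)
  show "el (r * x + (c False + c True)) True \<in> S \<longleftrightarrow> el x True \<in> S"
    using A[of "el 0 False" "el x True"] affineD[OF a]
    by (simp add: arc_el_iff[OF S] algebra_simps del: Cay_simps)
qed

section \<open>Permutations given by coordinates\<close>

lemma coordinate_bij:
  fixes F :: "int \<Rightarrow> bool \<Rightarrow> int" and E :: "int \<Rightarrow> bool \<Rightarrow> bool"
  assumes cong: "\<And>i j e. [i = j] (mod int n) \<Longrightarrow> [F i e = F j e] (mod int n) \<and> E i e = E j e"
    and inj: "\<And>i j e e'. [F i e = F j e'] (mod int n) \<Longrightarrow> E i e = E j e' \<Longrightarrow>
      [i = j] (mod int n) \<and> e = e'"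
  obtains f where "f \<in> Bij (carrier G)" "\<And>i e. f (el i e) = el (F i e) (E i e)"
proof -
  define f where "f = (\<lambda>x\<in>carrier G. THE y. \<exists>i e. x = el i e \<and> y = el (F i e) (E i e))"
  have f: "f (el i e) = el (F i e) (E i e)" for i e
  proof -
    have "(THE y. \<exists>i' e'. el i e = el i' e' \<and> y = el (F i' e') (E i' e')) = el (F i e) (E i e)"
    proof (rule the_equality)
      show "\<exists>i' e'. el i e = el i' e' \<and> el (F i e) (E i e) = el (F i' e') (E i' e')" by blast
      fix y assume "\<exists>i' e'. el i e = el i' e' \<and> y = el (F i' e') (E i' e')"
      then obtain i' e' where "el i e = el i' e'" and y: "y = el (F i' e') (E i' e')" by blast
      then have "[i' = i] (mod int n)" "e' = e" by (auto simp: el_eq_iff cong_sym)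
      then show "y = el (F i e) (E i e)" using cong[of i' i e] y by (auto simp: el_eq_iff)
    qed
    then show ?thesis by (simp add: f_def)
  qed
  have maps: "f ` carrier G \<subseteq> carrier G" by (auto simp: f elim!: el_cases)
  have "inj_on f (carrier G)"
  proof (rule inj_onI)
    fix x y assume xy: "x \<in> carrier G" "y \<in> carrier G" "f x = f y"
    obtain i e where x: "x = el i e" using xy(1) by (rule el_cases)
    obtain j e' where y: "y = el j e'" using xy(2) by (rule el_cases)
    show "x = y" using inj[of i e j e'] xy(3) unfolding x y f el_eq_iff by blast
  qed
  then have "bij_betw f (carrier G) (carrier G)"
    using endo_inj_surj[OF finite_carrier maps] by (auto simp: bij_betw_def)
  then have "f \<in> Bij (carrier G)" by (simp add: Bij_def f_def)
  then show ?thesis using f by (rule that)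
qed

text \<open>This is how normality gets contradicted later: exhibit coordinates of an arc-preserving
  permutation and find values that no single slope can produce.\<close>

lemma coordinate_aut_affine:
  fixes F :: "int \<Rightarrow> bool \<Rightarrow> int" and E :: "int \<Rightarrow> bool \<Rightarrow> bool"
  assumes n: "n \<ge> 3" and S: "connection_set G S" "normal_Cay G S"
    and cong: "\<And>i j e. [i = j] (mod int n) \<Longrightarrow> [F i e = F j e] (mod int n) \<and> E i e = E j e"
    and inj: "\<And>i j e e'. [F i e = F j e'] (mod int n) \<Longrightarrow> E i e = E j e' \<Longrightarrow>
      [i = j] (mod int n) \<and> e = e'"
    and arcs: "\<And>i j e e'.
      (if E i e = E j e' then el (F j e' - F i e) False \<in> S else el (F i e + F j e') True \<in> S) \<longleftrightarrow>
      (if e = e' then el (j - i) False \<in> S else el (i + j) True \<in> S)"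
  obtains r c \<epsilon> where "\<And>i e. [F i e = r * i + c e] (mod int n)" "\<And>i e. E i e = (e \<noteq> \<epsilon>)"
proof -
  have Sc: "S \<subseteq> carrier G" using S by (simp add: connection_set_def)
  obtain f where fB: "f \<in> Bij (carrier G)" and f: "\<And>i e. f (el i e) = el (F i e) (E i e)"
    using coordinate_bij[of F E, OF cong inj] by blast
  have "(f u, f v) \<in> parcs (Cay G S) \<longleftrightarrow> (u, v) \<in> parcs (Cay G S)"
    if "u \<in> carrier G" "v \<in> carrier G" for u v
    using that arcs by (auto simp: f arc_el_iff[OF Sc] elim!: el_cases simp del: Cay_simps)
  with fB have "f \<in> digraph_auts (Cay G S)"
    by (auto simp: digraph_auts_def simp del: Cay_simps(2))
  then obtain r c \<epsilon> where "affine r c \<epsilon> f" using normal_Cay_affine[OF n S] by blast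
  then have "el (F i e) (E i e) = el (r * i + c e) (e \<noteq> \<epsilon>)" for i e
    using f by (auto simp: affine_def)
  then show ?thesis by (intro that[of r c \<epsilon>]) (auto simp: el_eq_iff)
qed

end

section \<open>Isomorphisms between dihedral Cayley digraphs\<close>

locale dihedral_Cay_iso = dihedral_coords +
  fixes S T :: "'a set" and f :: "'a \<Rightarrow> 'a"
  assumes S: "connection_set G S" and T: "connection_set G T"
    and bij: "bij_betw f (carrier G) (carrier G)"
    and arcs: "\<And>u v. u \<in> carrier G \<Longrightarrow> v \<in> carrier G \<Longrightarrow>
      (u, v) \<in> parcs (Cay G S) \<longleftrightarrow> (f u, f v) \<in> parcs (Cay G T)"
begin

lemma S_carrier: "S \<subseteq> carrier G"
  using S by (simp add: connection_set_def)

lemma T_carrier: "T \<subseteq> carrier G"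
  using T by (simp add: connection_set_def)

lemma f_closed [simp]: "u \<in> carrier G \<Longrightarrow> f u \<in> carrier G"
  using bij by (auto simp: bij_betw_def)

lemma f_eq_iff: "u \<in> carrier G \<Longrightarrow> v \<in> carrier G \<Longrightarrow> f u = f v \<longleftrightarrow> u = v"
  using bij inj_on_eq_iff[of f "carrier G"] by (simp add: bij_betw_def)

text \<open>Right multiplication by \<open>g\<close> in the target, transported to the source along
  \<open>f\<close>. The restriction to the carrier makes it a member of \<open>Bij\<close>.\<close>

definition conj_mult :: "'a \<Rightarrow> 'a \<Rightarrow> 'a" where
  "conj_mult g = (\<lambda>u\<in>carrier G. inv_into (carrier G) f (f u \<otimes> g))"

lemma conj_mult:
  assumes "g \<in> carrier G" "u \<in> carrier G"
  shows conj_mult_closed [simp]: "conj_mult g u \<in> carrier G"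
    and f_conj_mult: "f (conj_mult g u) = f u \<otimes> g"
proof -
  have "f u \<otimes> g \<in> f ` carrier G" using assms bij by (simp add: bij_betw_def)
  then show "conj_mult g u \<in> carrier G" "f (conj_mult g u) = f u \<otimes> g"
    using assms by (simp_all add: conj_mult_def inv_into_into f_inv_into_f)
qed

lemma conj_mult_eqI: "g \<in> carrier G \<Longrightarrow> u \<in> carrier G \<Longrightarrow> v \<in> carrier G \<Longrightarrow>
    f v = f u \<otimes> g \<Longrightarrow> conj_mult g u = v"
  using f_eq_iff[of "conj_mult g u" v] by (simp add: f_conj_mult)

lemma conj_mult_mult:
  assumes "g \<in> carrier G" "h \<in> carrier G" "u \<in> carrier G"
  shows "conj_mult g (conj_mult h u) = conj_mult (h \<otimes> g) u"
  using assms by (intro conj_mult_eqI[symmetric]) (simp_all add: f_conj_mult m_assoc)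

lemma conj_mult_one: "u \<in> carrier G \<Longrightarrow> conj_mult \<one> u = u"
  by (rule conj_mult_eqI) auto

text \<open>The transported group still acts freely. Many contradictions below have this source:
  group elements whose maps agree at one vertex are equal.\<close>

lemma conj_mult_cancel:
  assumes "conj_mult g u = conj_mult h u" "g \<in> carrier G" "h \<in> carrier G" "u \<in> carrier G"
  shows "g = h"
  using arg_cong[OF assms(1), of f] assms(2-) l_cancel[of "f u" g h] by (simp add: f_conj_mult)

text \<open>\<open>f\<close> translates arcs of \<open>Cay G S\<close> into arcs of
  \<open>Cay G T\<close>, and these depend only on \<open>f v \<otimes> inv (f u)\<close>, which
  right multiplication by \<open>g\<close> leaves unchanged.\<close>

lemma conj_mult_aut:
  assumes g: "g \<in> carrier G"
  shows "conj_mult g \<in> digraph_auts (Cay G S)"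
proof -
  have inv: "conj_mult (inv g) (conj_mult g u) = u" "conj_mult g (conj_mult (inv g) u) = u"
    if "u \<in> carrier G" for u
    using g that by (simp_all add: conj_mult_mult conj_mult_one)
  have "bij_betw (conj_mult g) (carrier G) (carrier G)"
    by (rule bij_betwI[of _ _ _ "conj_mult (inv g)"]) (use g inv in auto)
  moreover have "(conj_mult g u, conj_mult g v) \<in> parcs (Cay G S) \<longleftrightarrow> (u, v) \<in> parcs (Cay G S)"
    if uv: "u \<in> carrier G" "v \<in> carrier G" for u v
  proof -
    have "f v \<otimes> g \<otimes> inv (f u \<otimes> g) = f v \<otimes> inv (f u)"
    proof -
      have "f v \<otimes> g \<otimes> inv (f u \<otimes> g) = f v \<otimes> (g \<otimes> (inv g \<otimes> inv (f u)))"
        using g uv by (simp add: m_assoc inv_mult_group)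
      also have "g \<otimes> (inv g \<otimes> inv (f u)) = g \<otimes> inv g \<otimes> inv (f u)"
        using g uv by (intro m_assoc[symmetric]) auto
      finally show ?thesis using g uv by simp
    qed
    then show ?thesis
      using g uv by (simp add: arcs f_conj_mult arc_Cay_iff[OF T_carrier] del: Cay_simps)
  qed
  moreover have "conj_mult g \<in> extensional (carrier G)" by (simp add: conj_mult_def)
  ultimately show ?thesis by (simp add: digraph_auts_def Bij_def del: Cay_simps(2))
qed

text \<open>Here conjugation by \<open>f\<close> carries the right regular group to itself, so
  \<open>f\<close> is a group automorphism followed by a right translation.\<close>

lemma auto_if_regular:
  assumes "\<And>g. g \<in> carrier G \<Longrightarrow> \<exists>x\<in>carrier G. \<forall>u\<in>carrier G. conj_mult g u = u \<otimes> x"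
  shows "\<exists>\<alpha>\<in>auto G. \<alpha> ` S = T"
proof (rule affine_iso_imp_auto[OF S T bij arcs conjugate_regular_imp_affine[OF bij]])
  fix g assume "g \<in> carrier G"
  then obtain x where "x \<in> carrier G" "\<forall>u\<in>carrier G. conj_mult g u = u \<otimes> x"
    using assms by blast
  moreover from this have "\<forall>u\<in>carrier G. f (u \<otimes> x) = f u \<otimes> g"
    using f_conj_mult[OF \<open>g \<in> carrier G\<close>] by simp
  ultimately show "\<exists>x\<in>carrier G. \<forall>u\<in>carrier G. f (u \<otimes> x) = f u \<otimes> g" by blast
qed

lemma auto_if_generators_regular:
  assumes a: "\<And>u. u \<in> carrier G \<Longrightarrow> conj_mult (el 1 False) u = u \<otimes> x" "x \<in> carrier G"
    and b: "\<And>u. u \<in> carrier G \<Longrightarrow> conj_mult (el 0 True) u = u \<otimes> y" "y \<in> carrier G"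
  shows "\<exists>\<alpha>\<in>auto G. \<alpha> ` S = T"
proof (rule auto_if_regular)
  let ?P = "\<lambda>g. \<exists>x\<in>carrier G. \<forall>u\<in>carrier G. conj_mult g u = u \<otimes> x"
  have mult: "?P (g \<otimes> h)" if gh: "g \<in> carrier G" "h \<in> carrier G" "?P g" "?P h" for g h
  proof -
    obtain x y where x: "x \<in> carrier G" "\<forall>u\<in>carrier G. conj_mult g u = u \<otimes> x"
      and y: "y \<in> carrier G" "\<forall>u\<in>carrier G. conj_mult h u = u \<otimes> y" using gh by blast
    have "conj_mult (g \<otimes> h) u = u \<otimes> (x \<otimes> y)" if "u \<in> carrier G" for u
      using conj_mult_mult[OF gh(2,1) that] x y that by (simp add: m_assoc)
    then show ?thesis using x y by blast
  qed
  have rot: "?P (el (int k) False)" for k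
  proof (induction k)
    case 0
    have "\<forall>u\<in>carrier G. conj_mult (el 0 False) u = u \<otimes> \<one>"
      by (simp add: one_el[symmetric] conj_mult_one)
    then show ?case by (intro bexI[of _ "\<one>"]) auto
  next
    case (Suc k)
    have "?P (el 1 False)" using a by blast
    then have "?P (el (int k) False \<otimes> el 1 False)" using Suc by (intro mult) auto
    then show ?case by (simp add: el_mult add.commute)
  qed
  fix g assume "g \<in> carrier G"
  then obtain i e where g: "g = el i e" "0 \<le> i" "i < int n" by (rule el_cases_range)
  have i: "?P (el i False)" using rot[of "nat i"] g(2) by simp
  show "?P g"
  proof (cases e)
    case True
    have "?P (el 0 True)" using b by blast
    then have "?P (el i False \<otimes> el 0 True)" using i by (intro mult) auto
    then show ?thesis using True g by (simp add: el_mult)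
  qed (use i g in simp)
qed

end

section \<open>Transported multiplications of a normal Cayley digraph\<close>

locale normal_dihedral_Cay_iso = dihedral_Cay_iso +
  assumes normal: "normal_Cay G S" and n_ge_3: "n \<ge> 3"
begin

lemma conj_mult_affine:
  assumes "g \<in> carrier G"
  obtains r c \<epsilon> where "affine r c \<epsilon> (conj_mult g)"
  using normal_Cay_affine[OF n_ge_3 S normal conj_mult_aut[OF assms]] by blast

lemma conj_mult_invariant:
  assumes "g \<in> carrier G" "affine r c \<epsilon> (conj_mult g)"
  shows "el (r * x) False \<in> S \<longleftrightarrow> el x False \<in> S"
    and "el (r * x + (c False + c True)) True \<in> S \<longleftrightarrow> el x True \<in> S"
  using affine_aut_invariant[OF S_carrier conj_mult_aut[OF assms(1)] assms(2)] by auto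

text \<open>If the rotations are carried to rotations, then the involution acts on them as
  multiplication by some \<open>r'\<close> with \<open>r'\<^sup>2 = 1\<close>. Multiplying only the coordinates of the
  rotations by \<open>r'\<close> is then an automorphism, and normality forces \<open>r' = 1\<close>.\<close>

lemma auto_if_translation:
  assumes aff: "affine r c False (conj_mult (el 1 False))" and r: "[r = 1] (mod int n)"
  shows "\<exists>\<alpha>\<in>auto G. \<alpha> ` S = T"
proof -
  have a: "conj_mult (el 1 False) (el i e) = el (i + c e) e" for i e
    using affineD[OF aff, of i e] cong_add[OF cong_mult[OF r cong_refl[of i]] cong_refl[of "c e"]]
    by (simp add: el_eq_iff)
  have ak: "conj_mult (el (int k) False) (el i e) = el (i + int k * c e) e" for k i e
  proof (induction k)
    case 0
    show ?case using conj_mult_one[of "el i e"] by (simp add: one_el)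
  next
    case (Suc k)
    have "el (int (Suc k)) False = el (int k) False \<otimes> el 1 False"
      by (simp add: el_mult add.commute)
    then show ?case
      using conj_mult_mult[of "el 1 False" "el (int k) False" "el i e"] Suc
      by (simp add: a algebra_simps)
  qed
  \<comment> \<open>For the common divisor \<open>g\<close>, the power \<open>k = n / g\<close> of
    the transported rotation fixes \<open>el 0 False\<close>; freeness makes \<open>k\<close> a
    multiple of \<open>n\<close>, so \<open>g = 1\<close>.\<close>
  have "coprime (c False) (int n)"
  proof -
    define g where "g = gcd (c False) (int n)"
    have g: "g > 0" "g dvd int n" "g dvd c False" using n_ge_3 by (auto simp: g_def)
    obtain k where k: "int n = g * k" using g(2) by blast
    have k0: "k > 0" using k g(1) n_ge_3 zero_less_mult_pos[of g k] by simp
    obtain m where m: "c False = g * m" using g(3) by blast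
    have "int (nat k) * c False = int n * m" using k m k0 by simp
    then have "conj_mult (el (int (nat k)) False) (el 0 False) = conj_mult (el 0 False) (el 0 False)"
      using ak[of "nat k" 0 False] ak[of 0 0 False] by (simp add: el_eq_iff cong_iff_dvd_diff)
    then have "el (int (nat k)) False = el 0 False" by (rule conj_mult_cancel) auto
    then have "int n dvd k" using k0 by (simp add: el_eq_iff cong_0_iff)
    then have "g dvd 1" using k k0 by auto
    then show ?thesis using g(1) by (simp add: g_def coprime_iff_gcd_eq_1)
  qed
  then obtain c' where c': "[c False * c' = 1] (mod int n)" using cong_solve_coprime_int by blast
  have solve: "\<exists>k::nat. [int k * c False = y] (mod int n)" for y
  proof -
    have "[(c' * y) mod int n * c False = c' * y * c False] (mod int n)"
      by (intro cong_mult cong_refl) (simp add: cong_def)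
    also have "[c' * y * c False = 1 * y] (mod int n)"
      using cong_mult[OF c' cong_refl[of y]] by (simp add: ac_simps)
    finally show ?thesis
      using n_ge_3 by (intro exI[of _ "nat ((c' * y) mod int n)"]) simp
  qed
  obtain r' d \<epsilon> where aff': "affine r' d \<epsilon> (conj_mult (el 0 True))"
    by (rule conj_mult_affine[of "el 0 True"]) auto
  \<comment> \<open>Powers of the transported rotation already reach every rotation from
    \<open>el 0 False\<close>, so freeness forbids the involution to stay among the
    rotations.\<close>
  have \<epsilon>
  proof (rule ccontr)
    assume "\<not> \<epsilon>"
    obtain k :: nat where k: "[int k * c False = d False] (mod int n)" using solve by blast
    then have "conj_mult (el 0 True) (el 0 False) = conj_mult (el (int k) False) (el 0 False)"
      using \<open>\<not> \<epsilon>\<close> by (simp add: affineD[OF aff'] ak el_eq_iff cong_sym)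
    then have "el 0 True = el (int k) False" by (rule conj_mult_cancel) auto
    then show False by (simp add: el_eq_iff)
  qed
  then have b: "conj_mult (el 0 True) (el i e) = el (r' * i + d e) (\<not> e)" for i e
    using affineD[OF aff', of i e] by auto
  have bb: "conj_mult (el 0 True) (conj_mult (el 0 True) u) = u" if "u \<in> carrier G" for u
    using that by (simp add: conj_mult_mult el_mult one_el[symmetric] conj_mult_one)
  have d: "[r' * d False + d True = 0] (mod int n)"
    using bb[of "el 0 False"] by (simp add: b el_eq_iff)
  have "[r' * (r' + d False) + d True = 1] (mod int n)"
    using bb[of "el 1 False"] by (simp add: b el_eq_iff)
  from cong_diff[OF this d] have r'2: "[r' * r' = 1] (mod int n)" by (simp add: algebra_simps)
  \<comment> \<open>The relation \<open>a b a = b\<close>, read at \<open>el 0 False\<close>, ties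
    the two offsets together.\<close>
  have "conj_mult (el 1 False) (conj_mult (el 0 True) (conj_mult (el 1 False) (el 0 False))) =
      conj_mult (el 0 True) (el 0 False)"
    by (simp add: conj_mult_mult el_mult del: of_nat_1)
  then have c: "[r' * c False + c True = 0] (mod int n)"
    by (simp add: a b el_eq_iff) (simp add: cong_iff_dvd_diff)
  have S0: "el (r' * x) False \<in> S \<longleftrightarrow> el x False \<in> S" for x
    by (rule conj_mult_invariant(1)[OF _ aff']) simp
  have S1': "el (x + int m * (c False + c True)) True \<in> S \<longleftrightarrow> el x True \<in> S" for x m
  proof (induction m)
    case (Suc m)
    have "el (r * (x + int m * (c False + c True)) + (c False + c True)) True =
       el (x + int (Suc m) * (c False + c True)) True"
      using cong_add[OF cong_mult[OF r cong_refl[of "x + int m * (c False + c True)"]]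
          cong_refl[of "c False + c True"]]
      by (simp add: el_eq_iff algebra_simps)
    then show ?case
      using conj_mult_invariant(2)[OF _ aff, of "x + int m * (c False + c True)"] Suc by simp
  qed simp
  \<comment> \<open>Modulo \<open>n\<close>, \<open>c False + c True\<close> is
    \<open>(1 - r') * c False\<close>. With \<open>y = k * c False\<close>, its \<open>k\<close>-th
    multiple is the difference between \<open>r' * y\<close> and \<open>y\<close>.\<close>
  have S1: "el (r' * y + z) True \<in> S \<longleftrightarrow> el (y + z) True \<in> S" for y z
  proof -
    obtain k :: nat where k: "[int k * c False = y] (mod int n)" using solve by blast
    have "[int k * c False + int k * (r' * c False + c True) - r' * (int k * c False) =
        y + int k * 0 - r' * y] (mod int n)"
      by (intro cong_add cong_diff cong_mult cong_refl k c)
    then have "[int k * (c False + c True) = y - r' * y] (mod int n)"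
      by (simp add: algebra_simps)
    from cong_add[OF cong_refl[of "r' * y + z"] this]
    have "el (r' * y + z + int k * (c False + c True)) True = el (y + z) True"
      by (simp add: el_eq_iff algebra_simps)
    then show ?thesis using S1'[of "r' * y + z" k] by simp
  qed
  define F where "F i e = (if e then i else r' * i)" for i :: int and e :: bool
  obtain q s \<delta> where F: "\<And>i e. [F i e = q * i + s e] (mod int n)"
  proof (rule coordinate_aut_affine[OF n_ge_3 S normal, of F "\<lambda>i e. e"])
    fix i j :: int and e e' :: bool
    assume F: "[F i e = F j e'] (mod int n)" "e = e'"
    have "[i = j] (mod int n)"
    proof (cases e)
      case False
      have "[i = r' * r' * i] (mod int n)"
        using cong_sym[OF cong_mult[OF r'2 cong_refl[of i]]] by simp
      also have "[r' * r' * i = r' * r' * j] (mod int n)"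
        using cong_mult[OF cong_refl[of r'], of "r' * i" "r' * j"] F False
        by (simp add: F_def mult.assoc)
      also have "[r' * r' * j = j] (mod int n)" using cong_mult[OF r'2 cong_refl[of j]] by simp
      finally show ?thesis .
    qed (use F in \<open>simp add: F_def\<close>)
    then show "[i = j] (mod int n) \<and> e = e'" using F by simp
  next
    fix i j :: int and e e' :: bool
    show "(if e = e' then el (F j e' - F i e) False \<in> S else el (F i e + F j e') True \<in> S) \<longleftrightarrow>
      (if e = e' then el (j - i) False \<in> S else el (i + j) True \<in> S)"
      using S0[of "j - i"] S1[of i j] S1[of j i]
      by (cases e; cases e') (simp_all add: F_def algebra_simps)
  qed (auto simp: F_def cong_mult)
  \<comment> \<open>On the reflections \<open>F\<close> is the identity, which pins the common slope
    \<open>q\<close> to 1; on the rotations the slope is \<open>r'\<close>.\<close>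
  have s: "[s True = 0] (mod int n)" using F[of 0 True] by (simp add: F_def cong_sym)
  have "[q = 1] (mod int n)"
    using cong_diff[OF cong_sym[OF F[of 1 True]] s] by (simp add: F_def)
  moreover have "[s False = 0] (mod int n)" using F[of 0 False] by (simp add: F_def cong_sym)
  ultimately have qs: "[q + s False = 1 + 0] (mod int n)" by (rule cong_add)
  have "[r' = q + s False] (mod int n)" using F[of 1 False] by (simp add: F_def)
  from cong_trans[OF this qs] have r'1: "[r' = 1] (mod int n)" by simp
  have c1: "[c True = - c False] (mod int n)"
    using cong_diff[OF c cong_mult[OF r'1 cong_refl[of "c False"]]]
    by (simp only: add_diff_cancel_left' diff_0 mult_1)
  have d1: "[d True = - d False] (mod int n)"
    using cong_diff[OF d cong_mult[OF r'1 cong_refl[of "d False"]]]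
    by (simp only: add_diff_cancel_left' diff_0 mult_1)
  show ?thesis
  proof (rule auto_if_generators_regular)
    fix u assume "u \<in> carrier G"
    then obtain i e where u: "u = el i e" by (rule el_cases)
    show "conj_mult (el 1 False) u = u \<otimes> el (c False) False"
      using cong_add[OF cong_refl[of i] c1] by (simp add: u a el_mult el_eq_iff)
    show "conj_mult (el 0 True) u = u \<otimes> el (d False) True"
      using cong_add[OF cong_mult[OF r'1 cong_refl[of i]] d1]
        cong_add[OF cong_mult[OF r'1 cong_refl[of i]] cong_refl[of "d False"]]
      by (simp add: u b el_mult el_eq_iff)
  qed auto
qed

end

section \<open>The dihedral group of order 8\<close>

context dihedral_coords
begin

text \<open>Takes \<open>a^s b\<close> as base reflection in place of \<open>b\<close>, so that a
  symmetry axis of the reflections in \<open>S\<close> can be moved to 0.\<close>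

lemma dihedral_coords_shift:
  "dihedral_coords G n (\<lambda>i e. el (i + (if e then s else 0)) e)"
proof
  show "carrier G = {el (i + (if e then s else 0)) e | i e. True}"
  proof (intro equalityI subsetI)
    fix x assume "x \<in> carrier G"
    then obtain i e where "x = el i e" by (rule el_cases)
    then have "x = el ((i - (if e then s else 0)) + (if e then s else 0)) e" by simp
    then show "x \<in> {el (i + (if e then s else 0)) e | i e. True}" by blast
  qed auto
  fix i j e e'
  show "el (i + (if e then s else 0)) e = el (j + (if e' then s else 0)) e' \<longleftrightarrow>
      [i = j] (mod int n) \<and> e = e'"
    by (auto simp: el_eq_iff cong_add_rcancel)
  show "el (i + (if e then s else 0)) e \<otimes> el (j + (if e' then s else 0)) e' =
      el ((if e then i - j else i + j) + (if e \<noteq> e' then s else 0)) (e \<noteq> e')"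
    by (cases e; cases e') (simp_all add: el_mult algebra_simps)
qed (rule n_ge_2)

text \<open>With representatives 0 to 3 and quantifiers over finite sets, both the arc condition and
  the conclusion become checks for the simplifier. Equal increments are the trace of a common
  slope.\<close>

lemma coordinate_aut_affine_4:
  fixes F :: "int \<times> bool \<Rightarrow> int \<times> bool"
  assumes n: "n = 4" and S: "connection_set G S" "normal_Cay G S"
    and range: "\<forall>i\<in>{0,1,2,3}. \<forall>e. fst (F (i, e)) \<in> {0,1,2,3}" and inj: "inj F"
    and arcs: "\<forall>i\<in>{0,1,2,3}. \<forall>j\<in>{0,1,2,3}. \<forall>e e'.
      (if snd (F (i, e)) = snd (F (j, e')) then el (fst (F (j, e')) - fst (F (i, e))) False \<in> S
       else el (fst (F (i, e)) + fst (F (j, e'))) True \<in> S) \<longleftrightarrow>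
      (if e = e' then el (j - i) False \<in> S else el (i + j) True \<in> S)"
  shows "\<forall>i\<in>{0,1,2}. \<forall>e. [fst (F (i + 1, e)) - fst (F (i, e)) = fst (F (1, False)) - fst (F (0, False))] (mod 4) \<and>
    snd (F (i + 1, e)) = snd (F (i, e))"
proof -
  have m: "i mod 4 \<in> {0,1,2,3}" for i :: int by simp presburger
  have small: "x = y" if "[x = y] (mod 4)" "x \<in> {0,1,2,3}" "y \<in> {0,1,2,3}" for x y :: int
    using that by (auto simp: cong_def)
  obtain r c \<epsilon> where *: "\<And>i e. [fst (F (i mod 4, e)) = r * i + c e] (mod int n)"
    "\<And>i e. snd (F (i mod 4, e)) = (e \<noteq> \<epsilon>)"
  proof (rule coordinate_aut_affine[OF _ S, of "\<lambda>i e. fst (F (i mod 4, e))" "\<lambda>i e. snd (F (i mod 4, e))"])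
    fix i j :: int and e e'
    assume a: "[fst (F (i mod 4, e)) = fst (F (j mod 4, e'))] (mod int n)"
      "snd (F (i mod 4, e)) = snd (F (j mod 4, e'))"
    have "fst (F (i mod 4, e)) = fst (F (j mod 4, e'))"
      using a(1) n by (intro small range[rule_format] m) simp
    with a(2) have "F (i mod 4, e) = F (j mod 4, e')" by (simp add: prod_eq_iff)
    then have "(i mod 4, e) = (j mod 4, e')" by (rule injD[OF inj])
    then show "[i = j] (mod int n) \<and> e = e'" using n by (simp add: cong_def)
  next
    fix i j :: int and e e'
    have "el (j mod 4 - i mod 4) False = el (j - i) False" "el (i mod 4 + j mod 4) True = el (i + j) True"
      using n by (auto simp: el_eq_iff cong_def mod_simps)
    then show "(if snd (F (i mod 4, e)) = snd (F (j mod 4, e'))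
         then el (fst (F (j mod 4, e')) - fst (F (i mod 4, e))) False \<in> S
         else el (fst (F (i mod 4, e)) + fst (F (j mod 4, e'))) True \<in> S) \<longleftrightarrow>
      (if e = e' then el (j - i) False \<in> S else el (i + j) True \<in> S)"
      using arcs[rule_format, OF m[of i] m[of j], of e e'] by simp
  qed (use n in \<open>auto simp: cong_def\<close>)
  have slope: "[fst (F (i + 1, e)) - fst (F (i, e)) = r] (mod 4)" if "i \<in> {0,1,2}" for i e
  proof -
    have "i mod 4 = i" "(i + 1) mod 4 = i + 1" using that by auto
    then show ?thesis
      using cong_diff[OF *(1)[of "i + 1" e] *(1)[of i e]] n by (simp add: algebra_simps)
  qed
  show ?thesis
  proof (intro ballI allI conjI)
    fix i :: int and e assume i: "i \<in> {0,1,2}"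
    show "[fst (F (i + 1, e)) - fst (F (i, e)) = fst (F (1, False)) - fst (F (0, False))] (mod 4)"
      using cong_trans[OF slope[OF i] cong_sym[OF slope[of 0 False]]] by simp
    have "i mod 4 = i" "(i + 1) mod 4 = i + 1" using i by auto
    then show "snd (F (i + 1, e)) = snd (F (i, e))"
      using *(2)[of i e] *(2)[of "i + 1" e] by simp
  qed
qed

text \<open>Group the vertices \<open>a\<^sup>i b\<^sup>e\<close> into four pairs by \<open>e\<close> and the parity of \<open>i\<close>. In case A one pair
  can be swapped alone, in case B the even vertices can be moved alone; D and F are the cube,
  C and E its complement.\<close>

lemma no_normal_symmetric_4_aux:
  assumes n: "n = 4" and S: "connection_set G S" "normal_Cay G S"
    and S0: "\<And>x. el (- x) False \<in> S \<longleftrightarrow> el x False \<in> S"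
    and S1: "\<And>x. el (- x) True \<in> S \<longleftrightarrow> el x True \<in> S"
    and 20: "el 2 True \<in> S \<Longrightarrow> el 0 True \<in> S"
  shows False
proof -
  let ?affine = "\<lambda>F :: int \<times> bool \<Rightarrow> int \<times> bool. \<forall>i\<in>{0,1,2}. \<forall>e.
    [fst (F (i + 1, e)) - fst (F (i, e)) = fst (F (1, False)) - fst (F (0, False))] (mod 4) \<and>
    snd (F (i + 1, e)) = snd (F (i, e))"
  note R = coordinate_aut_affine_4[OF n S]
  have el: "el (-1) e = el 3 e" "el (-2) e = el 2 e" "el (-3) e = el 1 e"
    "el 4 e = el 0 e" "el 5 e = el 1 e" "el 6 e = el 2 e" for e
    using n by (auto simp: el_eq_iff cong_def)
  have s: "el 3 False \<in> S \<longleftrightarrow> el 1 False \<in> S" "el 3 True \<in> S \<longleftrightarrow> el 1 True \<in> S"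
    using S0[of 1] S1[of 1] by (simp_all add: el)
  have expand: "(\<forall>i\<in>{0,1,2,3}. P i) \<longleftrightarrow> P 0 \<and> P 1 \<and> P 2 \<and> P 3" "(\<forall>i\<in>{0,1,2}. P i) \<longleftrightarrow> P 0 \<and> P 1 \<and> P 2"
    for P :: "int \<Rightarrow> bool" by auto
  note simps = transpose_def el s
  have inj: "inj (transpose p q \<circ> transpose p' q')" "inj (transpose p q)"
    for p q p' q' :: "int \<times> bool"
    by (rule inj_compose) (rule inj_on_transpose)+
  \<comment> \<open>By its symmetries \<open>S\<close> is determined by which of \<open>a\<close>,
    \<open>a^2\<close>, \<open>b\<close>, \<open>a b\<close>, \<open>a^2 b\<close> it contains.
    Outside \<open>A\<close>, the assumption \<open>20\<close> leaves only \<open>b\<close> inside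
    and \<open>a^2 b\<close> outside.\<close>
  consider (A) "el 0 True \<in> S \<longleftrightarrow> el 2 True \<in> S"
    | (B) "el 0 True \<in> S" "el 2 True \<notin> S" "el 1 True \<in> S \<longleftrightarrow> el 1 False \<in> S"
    | (C) "el 0 True \<in> S" "el 2 True \<notin> S" "el 1 False \<in> S" "el 1 True \<notin> S" "el 2 False \<in> S"
    | (D) "el 0 True \<in> S" "el 2 True \<notin> S" "el 1 False \<in> S" "el 1 True \<notin> S" "el 2 False \<notin> S"
    | (E) "el 0 True \<in> S" "el 2 True \<notin> S" "el 1 False \<notin> S" "el 1 True \<in> S" "el 2 False \<in> S"
    | (F) "el 0 True \<in> S" "el 2 True \<notin> S" "el 1 False \<notin> S" "el 1 True \<in> S" "el 2 False \<notin> S"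
    using 20 by blast
  then show False
  proof cases
    case A
    have "?affine (transpose (0, False) (2, False))"
      by (rule R[OF _ inj(2)]) (simp_all only: expand all_bool_eq, simp_all add: simps A)
    then show False by (simp only: expand all_bool_eq) (simp add: transpose_def cong_def)
  next
    case B
    have "?affine (transpose (0, False) (0, True) \<circ> transpose (2, False) (2, True))"
      by (rule R[OF _ inj(1)]) (simp_all only: expand all_bool_eq, simp_all add: simps B)
    then show False by (simp only: expand all_bool_eq) (simp add: transpose_def cong_def)
  next
    \<comment> \<open>In \<open>C\<close> and \<open>F\<close> the cube appears as the complete
      bipartite graph on 4 + 4 vertices minus a perfect matching, and two matched pairs are
      exchanged. In \<open>D\<close> and \<open>E\<close> it appears as a prism over a 4-cycle, and
      two diagonal corners are exchanged in each of two opposite faces.\<close>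
    case C
    have "?affine (transpose (0, False) (1, False) \<circ> transpose (0, True) (3, True))"
      by (rule R[OF _ inj(1)]) (simp_all only: expand all_bool_eq, simp_all add: simps C)
    then show False by (simp only: expand all_bool_eq) (simp add: transpose_def cong_def)
  next
    case D
    have "?affine (transpose (2, False) (3, True) \<circ> transpose (3, False) (0, True))"
      by (rule R[OF _ inj(1)]) (simp_all only: expand all_bool_eq, simp_all add: simps D)
    then show False by (simp only: expand all_bool_eq) (simp add: transpose_def cong_def)
  next
    case E
    have "?affine (transpose (0, False) (1, True) \<circ> transpose (3, False) (0, True))"
      by (rule R[OF _ inj(1)]) (simp_all only: expand all_bool_eq, simp_all add: simps E)
    then show False by (simp only: expand all_bool_eq) (simp add: transpose_def cong_def)
  next
    case F
    have "?affine (transpose (2, False) (3, False) \<circ> transpose (0, True) (3, True))"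
      by (rule R[OF _ inj(1)]) (simp_all only: expand all_bool_eq, simp_all add: simps F)
    then show False by (simp only: expand all_bool_eq) (simp add: transpose_def cong_def)
  qed
qed

text \<open>Both \<open>s\<close> and \<open>s + 2\<close> are axes, as their doubles agree modulo
  4. Measured from one of them, the reflections in \<open>S\<close> satisfy the extra assumption
  \<open>20\<close>.\<close>

lemma no_normal_symmetric_4:
  assumes n: "n = 4" and S: "connection_set G S" "normal_Cay G S"
    and S0: "\<And>x. el (- x) False \<in> S \<longleftrightarrow> el x False \<in> S"
    and S1: "\<And>x. el (2 * s - x) True \<in> S \<longleftrightarrow> el x True \<in> S"
  shows False
proof -
  have shift: False
    if t: "\<And>x. el (2 * t - x) True \<in> S \<longleftrightarrow> el x True \<in> S" "el (2 + t) True \<in> S \<Longrightarrow> el t True \<in> S" for t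
  proof -
    interpret sh: dihedral_coords G n "\<lambda>i e. el (i + (if e then t else 0)) e"
      by (rule dihedral_coords_shift)
    show False
    proof (rule sh.no_normal_symmetric_4_aux[OF n S])
      show "el (- x + (if True then t else 0)) True \<in> S \<longleftrightarrow> el (x + (if True then t else 0)) True \<in> S" for x
        using t(1)[of "x + t"] by simp
    qed (use S0 t in auto)
  qed
  have el4: "el (x + 4) True = el x True" for x using n by (simp add: el_eq_iff cong_def)
  show False
  proof (cases "el (2 + s) True \<in> S \<longrightarrow> el s True \<in> S")
    case False
    show False
    proof (rule shift[of "s + 2"])
      show "el (2 * (s + 2) - x) True \<in> S \<longleftrightarrow> el x True \<in> S" for x
        using S1[of x] el4[of "2 * s - x"] by (simp add: algebra_simps)
    qed (use False in \<open>simp add: add.commute\<close>)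
  qed (use shift[of s] S1 in blast)
qed

end

context normal_dihedral_Cay_iso
begin

text \<open>The transported rotation has odd slope. If it keeps the cosets, slope 3 would give its
  square a fixed point, so the slope is 1. If it exchanges them, some transported reflection keeps
  them; that one has slope 3 and odd offsets, which makes \<open>S\<close> too symmetric for
  normality.\<close>

lemma auto_if_4:
  assumes n: "n = 4"
  shows "\<exists>\<alpha>\<in>auto G. \<alpha> ` S = T"
proof -
  have fixfree: "conj_mult g (el i e) \<noteq> el i e" if "g \<in> carrier G" "g \<noteq> \<one>" for g i e
    using conj_mult_cancel[of g "el i e" \<one>] that by (auto simp: conj_mult_one)
  have square: "conj_mult g (conj_mult g (el i e)) = conj_mult (g \<otimes> g) (el i e)" if "g \<in> carrier G" for g i e
    using that by (simp add: conj_mult_mult)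
  obtain r c \<epsilon> where aff: "affine r c \<epsilon> (conj_mult (el 1 False))"
    by (rule conj_mult_affine[of "el 1 False"]) auto
  note a = affineD[OF aff]
  have aa: "conj_mult (el 1 False) (conj_mult (el 1 False) (el i e)) = conj_mult (el 2 False) (el i e)" for i e
    using square[of "el 1 False"] by (simp add: el_mult)
  have aaaa: "conj_mult (el 2 False) (conj_mult (el 2 False) (el i e)) = el i e" for i e
  proof -
    have "el 4 False = \<one>" using n by (simp add: one_el el_eq_iff cong_def)
    then show ?thesis using square[of "el 2 False" i e] by (simp add: el_mult conj_mult_one)
  qed
  have "el 2 False \<noteq> \<one>" using n by (simp add: one_el el_eq_iff cong_def)
  then have aa_fixfree: "conj_mult (el 2 False) (el i e) \<noteq> el i e" for i e by (intro fixfree) auto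
  have "odd r"
  proof
    assume "even r"
    then have "[r * 2 + c False = r * 0 + c False] (mod int n)"
      using n by (intro cong_add cong_refl) (auto simp: cong_0_iff elim!: evenE)
    then have "conj_mult (el 1 False) (el 2 False) = conj_mult (el 1 False) (el 0 False)"
      by (simp add: a el_eq_iff)
    from arg_cong[OF this, of f] have "f (el 2 False) = f (el 0 False)"
      by (simp add: f_conj_mult)
    then show False using \<open>el 2 False \<noteq> \<one>\<close> by (simp add: f_eq_iff one_el)
  qed
  show ?thesis
  proof (cases \<epsilon>)
    case False
    have "r mod 4 \<noteq> 3"
    proof
      assume "r mod 4 = 3"
      then have "4 dvd r + 1" by presburger
      then have "4 dvd (r + 1) * c False" by simp
      then have "el (r * c False + c False) False = el 0 False"
        using n by (simp add: el_eq_iff cong_0_iff algebra_simps)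
      then show False using aa_fixfree[of 0 False] False by (simp add: aa[symmetric] a)
    qed
    then have "[r = 1] (mod int n)" using \<open>odd r\<close> n unfolding cong_def by simp presburger
    then show ?thesis using aff False by (intro auto_if_translation) auto
  next
    case True
    \<comment> \<open>If the transported \<open>b\<close> exchanges the cosets as well, its
      composite with the transported \<open>a\<close> keeps them, and this is the map of
      \<open>a b\<close>.\<close>
    obtain k p d where t: "affine p d False (conj_mult (el k True))"
    proof -
      obtain p d \<delta> where b: "affine p d \<delta> (conj_mult (el 0 True))"
        by (rule conj_mult_affine[of "el 0 True"]) auto
      show thesis
      proof (cases \<delta>)
        case False
        then show thesis using b that by simp
      next
        case T: True
        have "conj_mult (el 1 True) (el i e) = conj_mult (el 0 True) (conj_mult (el 1 False) (el i e))" for i e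
          by (simp add: conj_mult_mult el_mult)
        then have "affine (p * r) (\<lambda>e. p * c e + d (\<not> e)) False (conj_mult (el 1 True))"
          using True T by (simp add: affine_def a affineD[OF b] algebra_simps)
        then show thesis by (rule that)
      qed
    qed
    have tt: "conj_mult (el k True) (conj_mult (el k True) (el i e)) = el i e" for i e
      using square[of "el k True" i e] by (simp add: el_mult one_el[symmetric] conj_mult_one)
    have t_fixfree: "conj_mult (el k True) (el i e) \<noteq> el i e" for i e
      by (intro fixfree) (auto simp: one_el el_eq_iff)
    have pd0: "[p * d False + d False = 0] (mod 4)"
      using tt[of 0 False] n by (simp add: affineD[OF t] el_eq_iff)
    have "[p * (p + d False) + d False = 1] (mod 4)"
      using tt[of 1 False] n by (simp add: affineD[OF t] el_eq_iff)
    from cong_diff[OF this pd0] have "[p * p = 1] (mod 4)" by (simp add: algebra_simps)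
    then have "[p * p = 1] (mod 2)" by (rule cong_dvd_modulus) simp
    then have "odd (p * p)" unfolding cong_def odd_iff_mod_2_eq_one by simp
    then have "odd p" by simp
    \<comment> \<open>A slope 1 would make this fixed-point-free involution move the rotations by 2.
      The transported \<open>a^2\<close> also moves \<open>el 0 False\<close> by 2, against
      freeness.\<close>
    have "p mod 4 = 3"
    proof (rule ccontr)
      assume "p mod 4 \<noteq> 3"
      then have p1: "[p = 1] (mod 4)" using \<open>odd p\<close> unfolding cong_def by presburger
      have "[d False + d False = 0] (mod 4)"
        using cong_trans[OF cong_sym[OF cong_add[OF cong_mult[OF p1 cong_refl] cong_refl]] pd0] by simp
      moreover have "\<not> [d False = 0] (mod 4)"
        using t_fixfree[of 0 False] n by (simp add: affineD[OF t] el_eq_iff)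
      ultimately have d2: "[d False = 2] (mod 4)" unfolding cong_def by presburger
      define \<gamma> where "\<gamma> = r * c False + c True"
      have A2: "conj_mult (el 2 False) (el i False) = el (r * r * i + \<gamma>) False" for i
        using True by (simp add: aa[symmetric] a \<gamma>_def algebra_simps)
      obtain m where m: "r = 2 * m + 1" using \<open>odd r\<close> by (rule oddE)
      have "[r * r = 1] (mod 4)"
        unfolding m by (simp add: cong_iff_dvd_diff algebra_simps)
      from cong_sym[OF cong_add[OF cong_mult[OF this cong_refl[of \<gamma>]] cong_refl[of \<gamma>]]]
      have "[\<gamma> + \<gamma> = r * r * \<gamma> + \<gamma>] (mod 4)" by simp
      also have "[r * r * \<gamma> + \<gamma> = 0] (mod 4)"
        using aaaa[of 0 False] n by (simp add: A2 el_eq_iff)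
      finally have "[\<gamma> + \<gamma> = 0] (mod 4)" .
      moreover have "\<not> [\<gamma> = 0] (mod 4)"
        using aa_fixfree[of 0 False] n by (simp add: A2 el_eq_iff)
      ultimately have "[\<gamma> = 2] (mod 4)" unfolding cong_def by presburger
      then have "conj_mult (el k True) (el 0 False) = conj_mult (el 2 False) (el 0 False)"
        using d2 n by (simp add: affineD[OF t] A2 el_eq_iff cong_def)
      then have "el k True = el 2 False" by (rule conj_mult_cancel) auto
      then show False by (simp add: el_eq_iff)
    qed
    then have p3: "4 dvd p + 1" by presburger
    \<comment> \<open>An even offset would give \<open>x \<mapsto> d e - x\<close> the fixed point
      \<open>d e / 2\<close>.\<close>
    have d_odd: "odd (d e)" for e
    proof
      assume "even (d e)"
      then obtain m where m: "d e = 2 * m" by (rule evenE)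
      have "4 dvd (p + 1) * m" using p3 by simp
      then have "[p * m + d e = m] (mod int n)"
        using n by (simp add: m cong_iff_dvd_diff algebra_simps)
      then show False using t_fixfree[of m e] by (simp add: affineD[OF t] el_eq_iff)
    qed
    \<comment> \<open>Half of this sum is the axis of the reflections in \<open>S\<close>.\<close>
    then have "even (d False + d True)" by simp
    then obtain s where s: "d False + d True = 2 * s" by (rule evenE)
    have px: "[p * x = - x] (mod int n)" for x
      using dvd_mult2[OF p3, of x] n by (simp add: cong_iff_dvd_diff algebra_simps)
    have False
    proof (rule no_normal_symmetric_4[OF n S normal])
      show "el (- x) False \<in> S \<longleftrightarrow> el x False \<in> S" for x
        using conj_mult_invariant(1)[OF _ t, of x] el_cong[OF px, of x False] by simp
      show "el (2 * s - x) True \<in> S \<longleftrightarrow> el x True \<in> S" for x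
        using conj_mult_invariant(2)[OF _ t, of x]
          el_cong[OF cong_add[OF px[of x] cong_refl[of "2 * s"]], of True]
        by (simp add: s)
    qed
    then show ?thesis ..
  qed
qed

end

section \<open>Dihedral groups of odd degree\<close>

lemma sum_power_add:
  "(\<Sum>j<a + b. (r :: int) ^ j) = (\<Sum>j<a. r ^ j) + r ^ a * (\<Sum>j<b. r ^ j)"
  by (induction b) (simp_all add: power_add algebra_simps)

lemma sum_power_mult:
  "(\<Sum>j<k * m. (r :: int) ^ j) = (\<Sum>j<k. r ^ j) * (\<Sum>j<m. (r ^ k) ^ j)"
proof (induction m)
  case (Suc m)
  have e: "k * Suc m = k * m + k" by simp
  show ?case unfolding e sum_power_add using Suc by (simp add: power_mult algebra_simps)
qed simp

text \<open>Lifting the exponent: modulo \<open>p^2\<close>, \<open>\<rho> ^ j\<close> is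
  \<open>1 + j * (\<rho> - 1)\<close>, and the sum of all \<open>j < p\<close> is a multiple of the
  odd prime \<open>p\<close>, so the geometric sum is \<open>p\<close>. Modulo any other prime
  divisor of \<open>n\<close> it is \<open>p\<close> as well, so \<open>w\<close> is coprime to
  \<open>n\<close> and can be cancelled later.\<close>

lemma sum_power_eq_prime_mult:
  fixes \<rho> :: int and n p :: nat
  assumes p: "normalization_semidom_class.prime p" "odd p" "p dvd n"
    and q: "\<And>q. normalization_semidom_class.prime q \<Longrightarrow> q dvd n \<Longrightarrow> int q dvd \<rho> - 1"
  obtains w where "(\<Sum>j<p. \<rho> ^ j) = int p * w" "coprime w (int n)"
proof -
  let ?p = "int p" and ?W = "\<Sum>j<p. \<rho> ^ j"
  obtain t where t: "\<rho> - 1 = ?p * t" using q[OF p(1,3)] by (auto simp: dvd_def)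
  have 1: "?p * ?p dvd \<rho> ^ j - 1 - int j * (\<rho> - 1)" for j
  proof (induction j)
    case (Suc j)
    have "\<rho> ^ Suc j - 1 - int (Suc j) * (\<rho> - 1) =
        \<rho> * (\<rho> ^ j - 1 - int j * (\<rho> - 1)) + int j * ((\<rho> - 1) * (\<rho> - 1))"
      by (simp add: algebra_simps)
    moreover have "?p * ?p dvd (\<rho> - 1) * (\<rho> - 1)" by (simp add: t mult_dvd_mono)
    ultimately show ?case using Suc by simp
  qed simp
  have "?p * ?p dvd (\<Sum>j<p. \<rho> ^ j - 1 - int j * (\<rho> - 1))" by (intro dvd_sum 1)
  also have "\<dots> = ?W - ?p - (\<Sum>j<p. int j) * (\<rho> - 1)"
    by (simp add: sum_subtractf sum_distrib_right)
  finally have 2: "?p * ?p dvd ?W - ?p - (\<Sum>j<p. int j) * (\<rho> - 1)" .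
  have "2 * (\<Sum>j<m. int j) = int m * (int m - 1)" for m
    by (induction m) (simp_all add: algebra_simps)
  then have "?p dvd 2 * (\<Sum>j<p. int j)" by simp
  moreover have "coprime ?p 2" using p(2) by simp
  ultimately have "?p dvd (\<Sum>j<p. int j)" by (simp add: coprime_dvd_mult_right_iff)
  then have "?p * ?p dvd (\<Sum>j<p. int j) * (\<rho> - 1)" unfolding t by (intro mult_dvd_mono) auto
  from dvd_add[OF 2 this] have "?p * ?p dvd ?W - ?p" by simp
  then obtain l where "?W - ?p = ?p * ?p * l" by (rule dvdE)
  then have W: "?W = ?p * (1 + ?p * l)" by (simp add: algebra_simps)
  have "coprime (1 + ?p * l) (int n)"
  proof (rule ccontr)
    assume "\<not> coprime (1 + ?p * l) (int n)"
    then obtain d where d: "d dvd 1 + ?p * l" "d dvd int n" "\<not> is_unit d" by (rule not_coprimeE)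
    then have "nat \<bar>d\<bar> \<noteq> 1" by auto
    then obtain q where "normalization_semidom_class.prime q" "q dvd nat \<bar>d\<bar>" by (meson prime_factor_nat)
    then have qd: "int q dvd d" by (simp add: int_dvd_int_iff[symmetric])
    have qn: "q dvd n" using dvd_trans[OF qd d(2)] by simp
    have qw: "int q dvd 1 + ?p * l" using dvd_trans[OF qd d(1)] .
    have "int q dvd \<rho> ^ j - 1" for j
    proof -
      have "\<rho> - 1 dvd \<rho> ^ j - 1" by (simp add: power_diff_1_eq)
      then show ?thesis using q[OF \<open>normalization_semidom_class.prime q\<close> qn] by (rule dvd_trans[rotated])
    qed
    then have "int q dvd (\<Sum>j<p. \<rho> ^ j - 1)" by (intro dvd_sum)
    then have "int q dvd ?W - ?p" by (simp add: sum_subtractf)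
    moreover have "int q dvd ?W" using qw by (simp add: W)
    ultimately have "int q dvd ?p" by (simp add: dvd_diff_right_iff)
    then have "q = p" using \<open>normalization_semidom_class.prime q\<close> p(1) by (simp add: primes_dvd_imp_eq)
    then have "?p dvd (1 + ?p * l) - ?p * l" using qw by (intro dvd_diff) auto
    then show False using p(1) by (auto dest: not_prime_unit)
  qed
  with W show thesis by (rule that)
qed

lemma power_prime_if_unique_prime_divisor:
  fixes m p :: nat
  assumes "m > 0" "normalization_semidom_class.prime p" and q: "\<And>q. normalization_semidom_class.prime q \<Longrightarrow> q dvd m \<Longrightarrow> q = p"
  obtains s where "m = p ^ s"
proof -
  obtain y where y: "m = p ^ multiplicity p m * y" "\<not> p dvd y"
    by (rule multiplicity_decompose'[of m p]) (use assms(1,2) in \<open>auto dest: not_prime_unit\<close>)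
  have "y = 1"
  proof (rule ccontr)
    assume "y \<noteq> 1"
    then obtain q' where "normalization_semidom_class.prime q'" "q' dvd y" by (meson prime_factor_nat)
    then show False using q[of q'] y by (metis dvd_mult)
  qed
  then show thesis using y(1) by (intro that) simp
qed

text \<open>As \<open>p\<close> divides \<open>\<pi>\<close>, moving \<open>x\<close> by multiples
  of \<open>\<pi>\<close> does not change \<open>\<pi> * (u * x + v)\<close> modulo
  \<open>\<pi> * p\<close>. Iteration therefore repeats one step \<open>\<pi> * y\<close>, where
  \<open>y\<close> is invertible modulo \<open>p\<close>, and some number of steps adds up to
  \<open>\<pi>\<close>.\<close>

lemma invariant_shift:
  fixes Q :: "int \<Rightarrow> bool"
  assumes p: "normalization_semidom_class.prime p" "int p dvd \<pi>"
    and periodic: "\<And>x y. [x = y] (mod \<pi> * int p) \<Longrightarrow> Q x = Q y"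
    and inv: "\<And>x. Q (x + \<pi> * (u * x + v)) = Q x"
    and x: "\<not> int p dvd u * x + v"
  shows "Q (x + \<pi>) = Q x"
proof -
  define y where "y = u * x + v"
  have iter: "Q (x + \<pi> * y * int t) = Q x" for t
  proof (induction t)
    case (Suc t)
    define x' where "x' = x + \<pi> * y * int t"
    obtain \<tau> where \<tau>: "\<pi> = int p * \<tau>" using p(2) by blast
    have "x' + \<pi> * (u * x' + v) - (x + \<pi> * y * int (Suc t)) = \<pi> * int p * (u * \<tau> * y * int t)"
      by (simp add: x'_def y_def \<tau> algebra_simps)
    then have "[x' + \<pi> * (u * x' + v) = x + \<pi> * y * int (Suc t)] (mod \<pi> * int p)"
      by (simp add: cong_iff_dvd_diff)
    then show ?case using Suc inv[of x'] periodic unfolding x'_def by blast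
  qed simp
  have "coprime y (int p)"
    using x p(1) unfolding y_def by (simp add: coprime_commute prime_imp_coprime)
  then obtain z where "[y * z = 1] (mod int p)" using cong_solve_coprime_int by blast
  moreover have "[y * (z mod int p) = y * z] (mod int p)" by (simp add: cong_def mod_mult_right_eq)
  ultimately have "[y * (z mod int p) = 1] (mod int p)" by (rule cong_trans[rotated])
  moreover have "int (nat (z mod int p)) = z mod int p" using p(1) by (simp add: prime_gt_0_nat)
  ultimately have "[y * int (nat (z mod int p)) = 1] (mod int p)" by simp
  then obtain t where "[y * int t = 1] (mod int p)" ..
  then obtain l where "y * int t - 1 = int p * l" unfolding cong_iff_dvd_diff by (rule dvdE)
  from arg_cong[OF this, of "\<lambda>a. \<pi> * a"]
  have "x + \<pi> * y * int t - (x + \<pi>) = \<pi> * int p * l" by (simp add: algebra_simps)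
  then have "[x + \<pi> * y * int t = x + \<pi>] (mod \<pi> * int p)" by (simp add: cong_iff_dvd_diff)
  then show ?thesis using iter[of t] periodic by blast
qed

context dihedral_coords
begin

text \<open>Translating by \<open>\<pi> = n / p\<close> inside one class modulo \<open>p\<close> of rotations and one of
  reflections is a non-affine automorphism.\<close>

lemma no_normal_class_invariant:
  assumes p: "normalization_semidom_class.prime p" "odd p" and \<pi>: "int n = \<pi> * int p" "int p dvd \<pi>"
    and S: "connection_set G S" "normal_Cay G S"
    and S0: "\<And>x. \<not> int p dvd x \<Longrightarrow> el (x + \<pi>) False \<in> S \<longleftrightarrow> el x False \<in> S"
    and S1: "\<And>x. \<not> [x = s] (mod int p) \<Longrightarrow> el (x + \<pi>) True \<in> S \<longleftrightarrow> el x True \<in> S"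
  shows False
proof -
  have p3: "p \<ge> 3" using p prime_ge_2_nat[of p] by (cases "p = 2") auto
  have \<pi>0: "\<pi> > 0" using \<pi>(1) n_ge_2 p3 zero_less_mult_pos2[of \<pi> "int p"] by simp
  have n3: "n \<ge> 3"
  proof -
    have "1 * int p \<le> \<pi> * int p" using \<pi>0 by (intro mult_right_mono) auto
    then show ?thesis using \<pi>(1) p3 by linarith
  qed
  have np: "int p dvd int n" using \<pi>(1) by simp
  have S0': "el (x - \<pi>) False \<in> S \<longleftrightarrow> el x False \<in> S" if "\<not> int p dvd x" for x
    using S0[of "x - \<pi>"] that \<pi>(2) by (simp add: dvd_diff_left_iff)
  have cong\<pi>: "[x - \<pi> = x] (mod int p)" "[x + \<pi> = x] (mod int p)" for x
    using \<pi>(2) by (simp_all add: cong_iff_dvd_diff)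
  have S1': "el (x - \<pi>) True \<in> S \<longleftrightarrow> el x True \<in> S" if "\<not> [x = s] (mod int p)" for x
  proof -
    have "\<not> [x - \<pi> = s] (mod int p)" using that cong_trans[OF cong_sym[OF cong\<pi>(1)[of x]]] by blast
    then show ?thesis using S1[of "x - \<pi>"] by simp
  qed
  \<comment> \<open>Class 2 leaves 0 and 1 unmoved, and \<open>p \<ge> 3\<close> separates the
    three. Reflections in the class \<open>s - 2\<close> are shifted the opposite way: between the
    two classes coordinates sum to \<open>s\<close> modulo \<open>p\<close>, where no periodicity is
    available, and opposite shifts keep the sum.\<close>
  define C where "C i e \<longleftrightarrow> [if e then s - i else i = 2] (mod int p)" for i e
  have C_cong: "C i e = C j e" if "[i = j] (mod int p)" for i j e
  proof -
    have "[if e then s - i else i = if e then s - j else j] (mod int p)"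
      using that by (auto intro: cong_diff)
    then show ?thesis by (simp add: C_def cong_def)
  qed
  define F where "F i e = i + (if C i e then if e then - \<pi> else \<pi> else 0)" for i e
  have Fp: "[F i e = i] (mod int p)" for i e
    using cong\<pi>[of i] by (auto simp: F_def)
  obtain r c \<epsilon> where F: "\<And>i e. [F i e = r * i + c e] (mod int n)"
  proof (rule coordinate_aut_affine[OF n3 S, of F "\<lambda>i e. e"])
    fix i j :: int and e :: bool
    assume ij: "[i = j] (mod int n)"
    then have "C i e = C j e" using C_cong cong_dvd_modulus np by blast
    then show "[F i e = F j e] (mod int n) \<and> e = e" using ij by (auto simp: F_def intro: cong_add cong_diff)
  next
    fix i j :: int and e e' :: bool
    assume a: "[F i e = F j e'] (mod int n)" "e = e'"
    have "[i = j] (mod int p)"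
      using cong_trans[OF cong_sym[OF Fp[of i e]] cong_trans[OF cong_dvd_modulus[OF a(1) np] Fp]] .
    then have "C i e = C j e" by (rule C_cong)
    define t where "t = (if C i e then if e then - \<pi> else \<pi> else 0)"
    have "F i e = i + t" "F j e' = j + t" using \<open>C i e = C j e\<close> a(2) by (auto simp: F_def t_def)
    then show "[i = j] (mod int n) \<and> e = e'" using a by (simp add: cong_add_rcancel)
  next
    fix i j :: int and e e' :: bool
    have same: "el (F j e - F i e) False \<in> S \<longleftrightarrow> el (j - i) False \<in> S"
    proof (cases "[i = j] (mod int p)")
      case True
      then show ?thesis using C_cong[OF True, of e] by (simp add: F_def)
    next
      case False
      then have "\<not> int p dvd j - i" by (metis cong_iff_dvd_diff cong_sym)
      then show ?thesis using S0[of "j - i"] S0'[of "j - i"]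
        by (auto simp: F_def algebra_simps)
    qed
    have diff: "el (F i False + F j True) True \<in> S \<longleftrightarrow> el (i + j) True \<in> S" for i j
    proof (cases "[i + j = s] (mod int p)")
      case True
      then have "[i = s - j] (mod int p)" by (simp add: cong_iff_dvd_diff algebra_simps)
      then have "C i False = C j True" by (simp add: C_def cong_def)
      then show ?thesis by (simp add: F_def)
    next
      case False
      then show ?thesis using S1[of "i + j"] S1'[of "i + j"] by (auto simp: F_def algebra_simps)
    qed
    show "(if e = e' then el (F j e' - F i e) False \<in> S else el (F i e + F j e') True \<in> S) \<longleftrightarrow>
      (if e = e' then el (j - i) False \<in> S else el (i + j) True \<in> S)"
      using same diff[of i j] diff[of j i] by (cases e; cases e') (simp_all add: add.commute)
  qed auto
  \<comment> \<open>The values at 0 and 1 force slope 1 and offset 0, which the value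
    \<open>2 + \<pi>\<close> at 2 contradicts.\<close>
  have "\<not> C 0 False" "\<not> C 1 False" "C 2 False"
    using p3 by (auto simp: C_def cong_iff_dvd_diff dest: zdvd_imp_le)
  then have "[0 = c False] (mod int n)" "[1 = r + c False] (mod int n)" "[2 + \<pi> = r * 2 + c False] (mod int n)"
    using F[of 0 False] F[of 1 False] F[of 2 False] by (simp_all add: F_def)
  then have "int n dvd 0 - c False" "int n dvd 1 - (r + c False)" "int n dvd 2 + \<pi> - (r * 2 + c False)"
    by (simp_all add: cong_iff_dvd_diff)
  from dvd_add[OF dvd_diff[OF this(3) dvd_mult[OF this(2), of 2]] this(1)]
  have "int n dvd \<pi>" by (simp add: algebra_simps)
  then have "int n \<le> \<pi>" using \<pi>0 by (rule zdvd_imp_le)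
  moreover have "\<pi> * 1 < \<pi> * int p" using \<pi>0 p3 by (intro mult_strict_left_mono) auto
  ultimately show False using \<pi>(1) by simp
qed

end

section \<open>Odd degree: the slope of the transported rotation\<close>

context normal_dihedral_Cay_iso
begin

lemma auto_if_odd:
  assumes odd: "odd n"
  shows "\<exists>\<alpha>\<in>auto G. \<alpha> ` S = T"
proof -
  let ?n = "int n"
  obtain r c \<epsilon> where aff: "affine r c \<epsilon> (conj_mult (el 1 False))"
    by (rule conj_mult_affine[of "el 1 False"]) auto
  have step: "conj_mult (el (int (Suc k)) False) (el i e) =
      conj_mult (el 1 False) (conj_mult (el (int k) False) (el i e))" for k i e
    by (simp add: conj_mult_mult el_mult add.commute)
  have el_n: "el (int n) False = \<one>" by (simp add: one_el el_eq_iff cong_0_iff)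
  \<comment> \<open>An exchanging map changes the coset at every step, but its \<open>n\<close>-th
    power is the identity and \<open>n\<close> is odd.\<close>
  have \<epsilon>: "\<not> \<epsilon>"
  proof
    assume \<epsilon>
    have "\<exists>j. conj_mult (el (int k) False) (el 0 False) = el j (odd k)" for k
    proof (induction k)
      case 0
      show ?case by (intro exI[of _ 0]) (simp add: one_el[symmetric] conj_mult_one)
    next
      case (Suc k)
      then obtain j where "conj_mult (el (int k) False) (el 0 False) = el j (odd k)" by blast
      then show ?case using \<open>\<epsilon>\<close> unfolding step by (auto simp: affineD[OF aff])
    qed
    from this[of n] show False using odd by (auto simp: el_n conj_mult_one el_eq_iff)
  qed
  define \<sigma> where "\<sigma> k = (\<Sum>j<k. r ^ j)" for k
  have pow: "affine (r ^ k) (\<lambda>e. c e * \<sigma> k) False (conj_mult (el (int k) False))" for k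
  proof (induction k)
    case 0
    show ?case by (simp add: affine_def \<sigma>_def one_el[symmetric] conj_mult_one)
  next
    case (Suc k)
    have \<sigma>: "\<sigma> (Suc k) = r * \<sigma> k + 1"
      using sum_power_add[of r 1 k] by (simp add: \<sigma>_def)
    show ?case unfolding affine_def step using \<epsilon>
      by (simp add: affineD[OF Suc] affineD[OF aff] \<sigma> algebra_simps)
  qed
  note powD = affineD[OF pow, simplified]
  have c\<sigma>n: "[c e * \<sigma> n = 0] (mod ?n)" for e
    using powD[of n 0 e] by (simp add: el_n conj_mult_one el_eq_iff cong_sym)
  have "[1 = r ^ n + c False * \<sigma> n] (mod ?n)"
    using powD[of n 1 False] by (simp add: el_n conj_mult_one el_eq_iff)
  from cong_diff[OF cong_sym[OF this] c\<sigma>n[of False]] have rn: "[r ^ n = 1] (mod ?n)" by simp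
  \<comment> \<open>By freeness the \<open>n\<close> images of \<open>el 0 False\<close> under the
    powers are distinct, so they exhaust the rotations.\<close>
  have surj: "\<exists>k. [c False * \<sigma> k = y] (mod ?n)" for y
  proof -
    let ?g = "\<lambda>k. (c False * \<sigma> k) mod ?n"
    have "inj_on ?g {..<n}"
    proof (rule inj_onI)
      fix k l assume kl: "k \<in> {..<n}" "l \<in> {..<n}" "?g k = ?g l"
      then have "conj_mult (el (int k) False) (el 0 False) = conj_mult (el (int l) False) (el 0 False)"
        by (simp add: powD el_eq_iff cong_def)
      then have "el (int k) False = el (int l) False" by (rule conj_mult_cancel) auto
      then show "k = l" using kl(1,2) by (simp add: el_eq_iff cong_def)
    qed
    then have "card (?g ` {..<n}) = card {0..<?n}" by (simp add: card_image)
    moreover have "?g ` {..<n} \<subseteq> {0..<?n}" using n_ge_3 by auto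
    ultimately have "?g ` {..<n} = {0..<?n}" by (intro card_subset_eq) auto
    moreover have "y mod ?n \<in> {0..<?n}" using n_ge_3 by simp
    ultimately obtain k where "y mod ?n = ?g k" by blast
    then show ?thesis by (intro exI[of _ k]) (simp add: cong_def)
  qed
  have geo: "(r - 1) * \<sigma> k = r ^ k - 1" for k by (simp add: \<sigma>_def power_diff_1_eq)
  have coprime_r: "coprime r ?n"
  proof -
    have "[r * r ^ (n - 1) = 1] (mod ?n)" using rn n_ge_3 by (simp add: power_eq_if)
    then show ?thesis using coprime_iff_invertible_int by blast
  qed
  have r1: "int q dvd r - 1" if q: "normalization_semidom_class.prime q" "q dvd n" for q
  proof (rule ccontr)
    assume nd: "\<not> int q dvd r - 1"
    have qn: "int q dvd ?n" using q(2) by simp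
    have "coprime (r - 1) (int q)"
      using nd q(1) by (simp add: coprime_commute prime_imp_coprime)
    then obtain z where z: "[(r - 1) * z = 1] (mod int q)" using cong_solve_coprime_int by blast
    \<comment> \<open>Modulo \<open>q\<close>, \<open>- z * c False\<close> is the fixed point of
      \<open>x \<mapsto> r * x + c False\<close>. An invertible map reaches its fixed point only by
      starting there, so 0 is that point and \<open>q\<close> divides \<open>c False\<close>,
      against \<open>surj\<close>.\<close>
    obtain k where k: "[c False * \<sigma> k = - z * c False] (mod ?n)" using surj by blast
    have "[(r - 1) * (c False * \<sigma> k) = (r - 1) * (- z * c False)] (mod int q)"
      by (intro cong_mult cong_refl cong_dvd_modulus[OF k qn])
    also have "(r - 1) * (- z * c False) = - ((r - 1) * z * c False)" by (simp add: algebra_simps)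
    also have "[- ((r - 1) * z * c False) = - (1 * c False)] (mod int q)"
      by (intro cong_mult cong_refl z cong_minus_minus_iff[THEN iffD2])
    finally have "[c False * ((r - 1) * \<sigma> k) = - c False] (mod int q)" by (simp add: ac_simps)
    then have "int q dvd c False * (r ^ k - 1) + c False" by (simp only: geo) (simp add: cong_iff_dvd_diff)
    then have "int q dvd c False * r ^ k" by (simp add: algebra_simps)
    moreover have "coprime (r ^ k) (int q)"
      using coprime_r qn by (auto intro: coprime_divisors[of r r "int q" ?n])
    ultimately have qc: "int q dvd c False"
      by (simp add: coprime_dvd_mult_left_iff coprime_commute)
    obtain l where "[c False * \<sigma> l = 1] (mod ?n)" using surj by blast
    then have "[c False * \<sigma> l = 1] (mod int q)" using qn by (rule cong_dvd_modulus)
    then have "int q dvd c False * \<sigma> l - 1" by (simp add: cong_iff_dvd_diff)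
    from dvd_diff[OF dvd_mult2[OF qc, of "\<sigma> l"] this] show False using q(1) by (auto dest: not_prime_unit)
  qed
  show ?thesis
  proof (cases "[r = 1] (mod ?n)")
    case True
    then show ?thesis using aff \<epsilon> by (intro auto_if_translation) auto
  next
    case False
    \<comment> \<open>For the largest such divisor \<open>k\<close>, \<open>\<rho> = r ^ k\<close>
      is not 1 but \<open>\<rho> ^ q\<close> is, for every prime \<open>q\<close> dividing
      \<open>n / k\<close>. Two different primes would give \<open>\<rho> = 1\<close> by Bezout, so
      \<open>n / k\<close> is a power of a single prime \<open>p\<close>.\<close>
    define A where "A = {k. k dvd n \<and> \<not> [r ^ k = 1] (mod ?n)}"
    define k where "k = Max A"
    have finA: "finite A" using n_ge_3 by (auto simp: A_def)
    have "1 \<in> A" using False by (simp add: A_def)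
    then have kA: "k \<in> A" unfolding k_def using finA by (intro Max_in) auto
    then have kn: "k dvd n" "\<not> [r ^ k = 1] (mod ?n)" by (auto simp: A_def)
    have k0: "k > 0" using kn(1) n_ge_3 by (intro Nat.gr0I) auto
    obtain m where m: "n = k * m" using kn(1) by blast
    have m0: "m > 0" using m n_ge_3 by (intro Nat.gr0I) auto
    have "m \<noteq> 1" using kn(2) rn m by auto
    then obtain p where p: "normalization_semidom_class.prime p" "p dvd m" using prime_factor_nat by blast
    define \<rho> where "\<rho> = r ^ k"
    have next_power: "[\<rho> ^ q = 1] (mod ?n)" if "normalization_semidom_class.prime q" "q dvd m" for q
    proof (rule ccontr)
      assume "\<not> [\<rho> ^ q = 1] (mod ?n)"
      then have "k * q \<in> A" using that(2) m by (simp add: A_def \<rho>_def power_mult)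
      then have "k * q \<le> k" unfolding k_def using finA by (intro Max_ge)
      then show False using k0 prime_ge_2_nat[OF that(1)] by simp
    qed
    have "q = p" if q: "normalization_semidom_class.prime q" "q dvd m" for q
    proof (rule ccontr)
      assume "q \<noteq> p"
      then have "coprime p q" using primes_coprime p(1) q(1) by blast
      moreover have "q \<noteq> 1" using q(1) by auto
      ultimately obtain x y where xy: "p * x = q * y + 1" using coprime_bezout_strong by blast
      have one: "[\<rho> ^ (p * x) = 1] (mod ?n)"
        using cong_pow[OF next_power[OF p], of x] by (simp add: power_mult)
      have "[\<rho> ^ (q * y) * \<rho> = 1 * \<rho>] (mod ?n)"
        using cong_pow[OF next_power[OF q], of y] by (intro cong_mult cong_refl) (simp add: power_mult)
      then have "[1 * \<rho> = \<rho> ^ (p * x)] (mod ?n)" unfolding xy by (simp add: cong_sym_eq mult.commute)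
      from cong_trans[OF this one] show False using kn(2) by (simp add: \<rho>_def)
    qed
    then obtain s where s: "m = p ^ s"
      by (rule power_prime_if_unique_prime_divisor[OF m0 p(1)])
    have pn: "p dvd n" using p(2) m by simp
    then have p_odd: "odd p" using odd by auto
    have \<rho>1: "int q dvd \<rho> - 1" if "normalization_semidom_class.prime q" "q dvd n" for q
    proof -
      have "r - 1 dvd \<rho> - 1" by (simp add: \<rho>_def power_diff_1_eq)
      then show ?thesis using r1[OF that] by (rule dvd_trans[rotated])
    qed
    obtain w where w: "(\<Sum>j<p. \<rho> ^ j) = int p * w" "coprime w ?n"
      by (rule sum_power_eq_prime_mult[OF p(1) p_odd pn \<rho>1])
    obtain n' where n': "n = p * n'" using pn by blast
    define \<pi> where "\<pi> = int n'"
    have \<pi>: "?n = \<pi> * int p" by (simp add: n' \<pi>_def)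
    have cancel_w: "?n dvd x" if "?n dvd x * w" for x
      using that w(2) by (simp add: coprime_dvd_mult_left_iff coprime_commute)
    have p0: "int p \<noteq> 0" using p(1) by auto
    have split: "\<exists>v. x = \<pi> * v" if "?n dvd x * int p" for x
    proof -
      have "\<pi> dvd x" using that p0 by (simp add: \<pi>)
      then show ?thesis by blast
    qed
    \<comment> \<open>Since \<open>\<rho> ^ p\<close> is 1 modulo \<open>n\<close> and
      \<open>w\<close> cancels, \<open>n\<close> divides \<open>(\<rho> - 1) * p\<close>: so
      \<open>\<rho> - 1\<close> is a multiple of \<open>n / p\<close>, yet not of
      \<open>n\<close>.\<close>
    have "\<rho> ^ p - 1 = (\<rho> - 1) * (int p * w)" by (simp add: power_diff_1_eq w(1))
    then have "?n dvd (\<rho> - 1) * int p * w"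
      using next_power[OF p] by (simp add: cong_iff_dvd_diff ac_simps)
    then have "?n dvd (\<rho> - 1) * int p" by (rule cancel_w)
    then obtain u where u: "\<rho> - 1 = \<pi> * u" using split by blast
    have pu: "\<not> int p dvd u"
    proof
      assume "int p dvd u"
      then have "?n dvd \<rho> - 1" by (simp add: u \<pi>)
      then show False using kn(2) by (simp add: \<rho>_def cong_iff_dvd_diff)
    qed
    have "int p dvd \<pi> * u" using \<rho>1[OF p(1) pn] by (simp add: u)
    then have p\<pi>: "int p dvd \<pi>"
      using pu p(1) by (simp add: prime_dvd_mult_iff)
    define D where "D = (c False + c True) * \<sigma> k"
    have inv: "el (\<rho> * x) False \<in> S \<longleftrightarrow> el x False \<in> S" "el (\<rho> * x + D) True \<in> S \<longleftrightarrow> el x True \<in> S" for x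
      using conj_mult_invariant[OF _ pow[of k], of x] by (simp_all add: \<rho>_def D_def algebra_simps)
    have S0: "el (x + \<pi>) False \<in> S \<longleftrightarrow> el x False \<in> S" if "\<not> int p dvd x" for x
    proof (rule invariant_shift[where Q = "\<lambda>x. el x False \<in> S" and u = u and v = 0 and p = p])
      show "el (x + \<pi> * (u * x + 0)) False \<in> S \<longleftrightarrow> el x False \<in> S" for x
      proof -
        have "x + \<pi> * (u * x + 0) = \<rho> * x" using u by (simp add: algebra_simps)
        then show ?thesis using inv(1)[of x] by simp
      qed
      show "\<not> int p dvd u * x + 0" using that pu p(1) by (simp add: prime_dvd_mult_iff)
      show "el x False \<in> S \<longleftrightarrow> el y False \<in> S" if "[x = y] (mod \<pi> * int p)" for x y
        using that \<pi> el_cong[of x y False] by simp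
    qed (use p(1) p\<pi> in auto)
    \<comment> \<open>Either the offset \<open>D\<close> is a multiple of \<open>\<pi>\<close>, and
      the reflections behave like the rotations, the exceptional class being where
      \<open>u * x + v\<close> vanishes modulo \<open>p\<close>; or a further power is a
      translation, and no class is exceptional.\<close>
    have "\<exists>t. \<forall>x. \<not> [x = t] (mod int p) \<longrightarrow> (el (x + \<pi>) True \<in> S \<longleftrightarrow> el x True \<in> S)"
    proof (cases "?n dvd D * int p")
      case True
      then obtain v where v: "D = \<pi> * v" using split by blast
      have "coprime u (int p)"
        using prime_imp_coprime[of "int p" u] pu p(1) by (simp add: coprime_commute)
      then obtain z where z: "[u * z = 1] (mod int p)" using cong_solve_coprime_int by blast
      show ?thesis
      proof (intro exI[of _ "- v * z"] allI impI)
        fix x assume x: "\<not> [x = - v * z] (mod int p)"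
        show "el (x + \<pi>) True \<in> S \<longleftrightarrow> el x True \<in> S"
        proof (rule invariant_shift[where Q = "\<lambda>x. el x True \<in> S" and u = u and v = v and p = p])
          show "el (x + \<pi> * (u * x + v)) True \<in> S \<longleftrightarrow> el x True \<in> S" for x
          proof -
            have "x + \<pi> * (u * x + v) = \<rho> * x + D" using u v by (simp add: algebra_simps)
            then show ?thesis using inv(2)[of x] by simp
          qed
          show "\<not> int p dvd u * x + v"
          proof
            assume "int p dvd u * x + v"
            from dvd_diff[OF dvd_mult2[OF this, of z] dvd_mult[OF z[unfolded cong_iff_dvd_diff], of x]]
            show False using x by (simp add: cong_iff_dvd_diff algebra_simps)
          qed
          show "el x True \<in> S \<longleftrightarrow> el y True \<in> S" if "[x = y] (mod \<pi> * int p)" for x y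
            using that \<pi> el_cong[of x y True] by simp
        qed (use p(1) p\<pi> in auto)
      qed
    next
      case False
      \<comment> \<open>The \<open>p\<close>-th power of the map has slope 1 and offset
        \<open>D * p * w\<close>, which is not 0 modulo \<open>n\<close> in this case.\<close>
      define D' where "D' = (c False + c True) * \<sigma> (k * p)"
      have D': "D' = D * int p * w"
        using w(1) by (simp add: D'_def D_def \<sigma>_def \<rho>_def sum_power_mult)
      have rkp: "[r ^ (k * p) = 1] (mod ?n)" using next_power[OF p] by (simp add: \<rho>_def power_mult)
      have inv': "el (r ^ (k * p) * y + D') True \<in> S \<longleftrightarrow> el y True \<in> S" for y
        using conj_mult_invariant(2)[OF _ pow[of "k * p"], of y] by (simp only: D'_def distrib_right el_closed)
      have S1D: "el (x + D' * int j) True \<in> S \<longleftrightarrow> el x True \<in> S" for x j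
      proof (induction j)
        case (Suc j)
        have "[r ^ (k * p) * (x + D' * int j) + D' = 1 * (x + D' * int j) + D'] (mod ?n)"
          by (intro cong_add cong_mult rkp cong_refl)
        moreover have "1 * (x + D' * int j) + D' = x + D' * int (Suc j)" by (simp add: algebra_simps)
        ultimately have "el (r ^ (k * p) * (x + D' * int j) + D') True = el (x + D' * int (Suc j)) True"
          by (intro el_cong) (simp only:)
        then show ?case using inv'[of "x + D' * int j"] Suc by (simp only:)
      qed simp
      have \<sigma>j: "[\<sigma> (k * p * j) = int j * \<sigma> (k * p)] (mod ?n)" for j
      proof (induction j)
        case (Suc j)
        have e: "k * p * Suc j = k * p * j + k * p" by simp
        have "[(r ^ (k * p)) ^ j = 1 ^ j] (mod ?n)" by (rule cong_pow[OF rkp])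
        then have "[\<sigma> (k * p * j) + (r ^ (k * p)) ^ j * \<sigma> (k * p) =
            int j * \<sigma> (k * p) + 1 * \<sigma> (k * p)] (mod ?n)"
          by (intro cong_add cong_mult Suc cong_refl) simp
        moreover have "\<sigma> (k * p * Suc j) = \<sigma> (k * p * j) + (r ^ (k * p)) ^ j * \<sigma> (k * p)"
          unfolding e \<sigma>_def sum_power_add power_mult[of r "k * p" j] ..
        moreover have "int (Suc j) * \<sigma> (k * p) = int j * \<sigma> (k * p) + 1 * \<sigma> (k * p)"
          by (simp add: algebra_simps)
        ultimately show ?case by (simp only:)
      qed (simp add: \<sigma>_def)
      have "s \<noteq> 0" using s \<open>m \<noteq> 1\<close> by auto
      then obtain s' where s': "s = Suc s'" by (cases s) auto
      have n_eq: "n = k * p * p ^ s'" by (simp add: m s s')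
      have "[c False * \<sigma> n + c True * \<sigma> n = 0 + 0] (mod ?n)" by (intro cong_add c\<sigma>n)
      then have c0: "[(c False + c True) * \<sigma> n = 0] (mod ?n)" by (simp add: algebra_simps)
      have "[(c False + c True) * \<sigma> n = (c False + c True) * (int (p ^ s') * \<sigma> (k * p))] (mod ?n)"
        using \<sigma>j[of "p ^ s'"] unfolding n_eq[symmetric] by (intro cong_mult cong_refl)
      from cong_trans[OF cong_sym[OF this] c0]
      have "[(c False + c True) * (int (p ^ s') * \<sigma> (k * p)) = 0] (mod ?n)" .
      then have ex: "?n dvd D' * int p ^ s'" by (simp add: D'_def cong_0_iff ac_simps)
      \<comment> \<open>By \<open>ex\<close> the order of \<open>D'\<close> modulo \<open>n\<close>
        is a power of \<open>p\<close>. One factor \<open>p\<close> before the multiple of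
        \<open>D'\<close> vanishes, it has the form \<open>\<pi> * v\<close> with \<open>p\<close>
        not dividing \<open>v\<close>.\<close>
      define i where "i = (LEAST i. ?n dvd D' * int p ^ i)"
      have i: "?n dvd D' * int p ^ i" unfolding i_def using ex by (rule LeastI)
      have "\<not> ?n dvd D'" unfolding D' using False cancel_w by blast
      have "i \<noteq> 0"
      proof
        assume "i = 0"
        then show False using i \<open>\<not> ?n dvd D'\<close> by simp
      qed
      then obtain i' where i': "i = Suc i'" by (cases i) auto
      have ni: "\<not> ?n dvd D' * int p ^ i'"
      proof (rule not_less_Least)
        show "i' < (LEAST i. ?n dvd D' * int p ^ i)" unfolding i_def[symmetric] i' by simp
      qed
      have "?n dvd D' * int p ^ i' * int p" using i by (simp add: i' ac_simps)
      then obtain v where v: "D' * int p ^ i' = \<pi> * v" using split by blast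
      have pv: "\<not> int p dvd v"
      proof
        assume "int p dvd v"
        then have "?n dvd \<pi> * v" by (simp add: \<pi>)
        then show False using ni v by simp
      qed
      have "el (x + \<pi>) True \<in> S \<longleftrightarrow> el x True \<in> S" for x
      proof (rule invariant_shift[where Q = "\<lambda>x. el x True \<in> S" and u = 0 and v = v and p = p])
        show "el (x + \<pi> * (0 * x + v)) True \<in> S \<longleftrightarrow> el x True \<in> S" for x
          using S1D[of x "p ^ i'"] v by simp
        show "el x True \<in> S \<longleftrightarrow> el y True \<in> S" if "[x = y] (mod \<pi> * int p)" for x y
          using that \<pi> el_cong[of x y True] by simp
      qed (use p(1) p\<pi> pv in auto)
      then show ?thesis by simp
    qed
    then obtain t where t: "\<forall>x. \<not> [x = t] (mod int p) \<longrightarrow> (el (x + \<pi>) True \<in> S \<longleftrightarrow> el x True \<in> S)" ..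
    have False by (rule no_normal_class_invariant[OF p(1) p_odd \<pi> p\<pi> S normal S0 t[rule_format]])
    then show ?thesis ..
  qed
qed

end

section \<open>The Klein four-group\<close>

context dihedral_coords
begin

lemma card_carrier: "card (carrier G) = 2 * n"
proof -
  let ?N = "{0..<int n} \<times> (UNIV :: bool set)"
  have "inj_on (case_prod el) ?N"
    by (auto simp: inj_on_def el_eq_iff cong_def)
  moreover have "case_prod el ` ?N = carrier G"
  proof
    show "carrier G \<subseteq> case_prod el ` ?N"
    proof
      fix x assume "x \<in> carrier G"
      then obtain i e where "x = el i e" "0 \<le> i" "i < int n" by (rule el_cases_range)
      then show "x \<in> case_prod el ` ?N" by (intro image_eqI[of _ _ "(i, e)"]) auto
    qed
  qed auto
  ultimately have "card (carrier G) = card ?N" by (metis card_image)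
  then show ?thesis by (simp add: card_cartesian_product)
qed

text \<open>The Klein four-group is the affine plane over the field with two elements: each point is
  the product of the three others. For distinct \<open>\<one>\<close>, \<open>x\<close>,
  \<open>y\<close>, the value \<open>f (x \<otimes> y)\<close> is the point missing from
  \<open>f x\<close>, \<open>f \<one>\<close>, \<open>f y\<close>.\<close>

lemma bij_translate_2:
  assumes n: "n = 2" and bij: "bij_betw f (carrier G) (carrier G)"
    and x: "x \<in> carrier G" and y: "y \<in> carrier G"
  shows "f (x \<otimes> y) = f x \<otimes> inv (f \<one>) \<otimes> f y"
proof -
  have square: "u \<otimes> u = \<one>" if "u \<in> carrier G" for u
    using that n by (auto simp: el_mult one_el el_eq_iff cong_0_iff elim!: el_cases)
  have inv: "inv u = u" if "u \<in> carrier G" for u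
    using that square by (intro inv_equality) auto
  have comm: "u \<otimes> v = v \<otimes> u" if "u \<in> carrier G" "v \<in> carrier G" for u v
    using inv_mult_group[of u v] that by (simp add: inv)
  have closed [simp]: "f u \<in> carrier G" if "u \<in> carrier G" for u
    using bij that by (auto simp: bij_betw_def)
  have inj: "f u \<noteq> f v" if "u \<noteq> v" "u \<in> carrier G" "v \<in> carrier G" for u v
    using bij that by (auto simp: bij_betw_def dest: inj_onD)
  have fourth: "s = p \<otimes> q \<otimes> r"
    if c: "p \<in> carrier G" "q \<in> carrier G" "r \<in> carrier G" "s \<in> carrier G"
      and d: "p \<noteq> q" "p \<noteq> r" "q \<noteq> r" "s \<noteq> p" "s \<noteq> q" "s \<noteq> r" for p q r s
  proof -
    have [simp]: "u \<otimes> (u \<otimes> v) = v" if "u \<in> carrier G" "v \<in> carrier G" for u v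
      using that square by (simp add: m_assoc[symmetric])
    have ne: "u \<otimes> v \<noteq> \<one>" if "u \<in> carrier G" "v \<in> carrier G" "u \<noteq> v" for u v
      using that inv_equality[of u v] inv[of v] by auto
    have "p \<otimes> q \<otimes> r \<noteq> p"
      using ne[of q r] c d by (simp add: m_assoc)
    moreover have "p \<otimes> q \<otimes> r \<noteq> q"
      using ne[of p r] c d comm[of p q] by (simp add: m_assoc)
    moreover have "p \<otimes> q \<otimes> r \<noteq> r"
      using ne[of p q] c d by simp
    ultimately have "card {p, q, r, p \<otimes> q \<otimes> r} = 4" using d by auto
    then have "{p, q, r, p \<otimes> q \<otimes> r} = carrier G"
      using c n by (intro card_subset_eq[OF finite_carrier]) (auto simp: card_carrier)
    then show ?thesis using c(4) d by auto
  qed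
  show ?thesis
  proof (cases "x = \<one> \<or> y = \<one> \<or> x = y")
    case True
    then show ?thesis
    proof (elim disjE)
      assume "x = y"
      then show ?thesis
        using x comm[of "f x" "inv (f \<one>)"] by (simp add: square inv m_assoc)
    qed (use x y in \<open>simp_all add: m_assoc\<close>)
  next
    case False
    have "x \<otimes> y \<noteq> \<one>" using False x y inv_equality[of x y] inv[of y] by auto
    moreover have "x \<otimes> y \<noteq> x" "x \<otimes> y \<noteq> y" using False x y by auto
    ultimately have "f (x \<otimes> y) = f x \<otimes> f \<one> \<otimes> f y"
      using False x y by (intro fourth inj) auto
    then show ?thesis by (simp add: inv)
  qed
qed

end

lemma (in dihedral_Cay_iso) auto_if_2:
  assumes "n = 2"
  shows "\<exists>\<alpha>\<in>auto G. \<alpha> ` S = T"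
  by (rule affine_iso_imp_auto[OF S T bij arcs bij_translate_2[OF assms bij]])

section \<open>Prisms\<close>

context dihedral_coords
begin

text \<open>The element \<open>b\<close> joins exponent \<open>i\<close> to exponent
  \<open>- i\<close>, so the two rims are numbered in opposite directions.\<close>

definition prism :: "'a set" where
  "prism = {el 1 False, el (- 1) False, el 0 True}"

lemma connection_set_prism: "connection_set G prism"
  using n_ge_2 by (auto simp: connection_set_def prism_def one_el el_eq_iff cong_iff_dvd_diff)

lemma arc_prism_iff:
  "(el i e, el j e') \<in> parcs (Cay G prism) \<longleftrightarrow>
    (if e = e' then [j = i + 1] (mod int n) \<or> [j = i - 1] (mod int n) else [j = - i] (mod int n))"
proof -
  have "prism \<subseteq> carrier G" by (auto simp: prism_def)
  from arc_el_iff[OF this, of i e j e'] show ?thesis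
    by (auto simp: prism_def el_eq_iff cong_iff_dvd_diff algebra_simps simp del: Cay_simps)
qed

text \<open>Every other edge at \<open>u\<close> lies in a 4-cycle with \<open>uv\<close>: this singles out the rungs of the prism.\<close>

definition rung :: "'a \<Rightarrow> 'a \<Rightarrow> bool" where
  "rung u v \<longleftrightarrow> (u, v) \<in> parcs (Cay G prism) \<and>
    (\<forall>u'\<in>carrier G. (u, u') \<in> parcs (Cay G prism) \<and> u' \<noteq> v \<longrightarrow>
      (\<exists>v'\<in>carrier G. (v, v') \<in> parcs (Cay G prism) \<and> v' \<noteq> u \<and> (u', v') \<in> parcs (Cay G prism)))"

text \<open>A rim edge fails the test at the other rim neighbour \<open>el (i - s) e\<close>: a
  common neighbour of it and \<open>el (i + s) e\<close> besides \<open>el i e\<close> would force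
  \<open>n\<close> to divide 2 or 4.\<close>

lemma rung_iff:
  assumes "n \<ge> 5"
  shows "rung (el i e) (el j e') \<longleftrightarrow> e \<noteq> e' \<and> [j = - i] (mod int n)"
proof
  assume r: "e \<noteq> e' \<and> [j = - i] (mod int n)"
  then have j: "el j e' = el (- i) (\<not> e)" by (auto simp: el_eq_iff)
  show "rung (el i e) (el j e')"
    unfolding rung_def j
  proof (intro conjI ballI impI)
    fix u' assume u': "u' \<in> carrier G" "(el i e, u') \<in> parcs (Cay G prism) \<and> u' \<noteq> el (- i) (\<not> e)"
    obtain k d where k: "u' = el k d" using u'(1) by (rule el_cases)
    have d: "d = e" and k1: "[k = i + 1] (mod int n) \<or> [k = i - 1] (mod int n)"
      using u'(2) unfolding k arc_prism_iff by (auto simp: el_eq_iff split: if_splits)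
    have "[- k = - i - 1] (mod int n) \<or> [- k = - i + 1] (mod int n)"
      using k1 by (auto simp: cong_iff_dvd_diff algebra_simps dvd_diff_commute)
    then show "\<exists>v'\<in>carrier G. (el (- i) (\<not> e), v') \<in> parcs (Cay G prism) \<and> v' \<noteq> el i e \<and>
        (u', v') \<in> parcs (Cay G prism)"
      unfolding k d by (intro bexI[of _ "el (- k) (\<not> e)"]) (auto simp: arc_prism_iff el_eq_iff simp del: Cay_simps)
  qed (simp add: arc_prism_iff del: Cay_simps)
next
  assume r: "rung (el i e) (el j e')"
  then have arc: "(el i e, el j e') \<in> parcs (Cay G prism)" by (simp add: rung_def)
  show "e \<noteq> e' \<and> [j = - i] (mod int n)"
  proof (cases "e = e'")
    case True
    then have "[j = i + 1] (mod int n) \<or> [j = i - 1] (mod int n)" using arc unfolding arc_prism_iff by simp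
    then obtain s :: int where s: "s = 1 \<or> s = - 1" "[j = i + s] (mod int n)" by force
    have small: "\<not> int n dvd m" if "m \<in> {2, -2, 4, -4}" for m
      using that assms zdvd_imp_le[of "int n" "\<bar>m\<bar>"] by auto
    have j: "el j e' = el (i + s) e" using s(2) True by (simp add: el_eq_iff)
    have "(el i e, el (i - s) e) \<in> parcs (Cay G prism)" using s(1) by (auto simp: arc_prism_iff simp del: Cay_simps)
    moreover have "el (i - s) e \<noteq> el (i + s) e"
      using s(1) small by (auto simp: el_eq_iff cong_iff_dvd_diff)
    ultimately obtain v' where v': "v' \<in> carrier G" "(el (i + s) e, v') \<in> parcs (Cay G prism)"
      "v' \<noteq> el i e" "(el (i - s) e, v') \<in> parcs (Cay G prism)"
      using r unfolding rung_def j by blast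
    obtain k d where k: "v' = el k d" using v'(1) by (rule el_cases)
    have False
    proof (cases "d = e")
      case True
      have ki: "\<not> int n dvd k - i" using v'(3) True by (simp add: k el_eq_iff cong_iff_dvd_diff)
      have "int n dvd k - (i + s + 1) \<or> int n dvd k - (i + s - 1)"
        "int n dvd k - (i - s + 1) \<or> int n dvd k - (i - s - 1)"
        using v'(2,4) True unfolding k arc_prism_iff by (auto simp: cong_iff_dvd_diff)
      then have "int n dvd k - (i + 2 * s)" "int n dvd k - (i - 2 * s)"
        using s(1) ki by (auto simp: algebra_simps)
      from dvd_diff[OF this] show False using s(1) small[of 4] small[of "-4"] by auto
    next
      case False
      then have "int n dvd k + (i + s)" "int n dvd k + (i - s)"
        using v'(2,4) unfolding k arc_prism_iff by (auto simp: cong_iff_dvd_diff algebra_simps)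
      from dvd_diff[OF this] show False using s(1) small[of 2] small[of "-2"] by auto
    qed
    then show ?thesis ..
  next
    case False
    then show ?thesis using arc unfolding arc_prism_iff by simp
  qed
qed

text \<open>The relation between the offsets is the one that the rungs impose on an automorphism of
  the prism.\<close>

lemma affine_imp_translate:
  assumes f: "affine r c \<epsilon> f" and c: "c True = - c False"
    and "x \<in> carrier G" "y \<in> carrier G"
  shows "f (x \<otimes> y) = f x \<otimes> inv (f \<one>) \<otimes> f y"
proof -
  obtain i e where x: "x = el i e" using assms(3) by (rule el_cases)
  obtain j e' where y: "y = el j e'" using assms(4) by (rule el_cases)
  show ?thesis unfolding x y
    by (cases e; cases e'; cases \<epsilon>)
      (simp_all add: one_el el_mult inv_el affineD[OF f] c algebra_simps)
qed

text \<open>Automorphisms preserve rungs, hence send rims to rims. By injectivity the image of a rim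
  never turns back, so it advances by a constant step 1 or -1, and the rungs carry this over to the
  other rim.\<close>

lemma normal_prism:
  assumes n: "n \<ge> 5"
  shows "normal_Cay G prism"
  unfolding normal_Cay_iff[OF connection_set_prism]
proof (intro ballI)
  fix f x y assume f: "f \<in> digraph_auts (Cay G prism)" and xy: "x \<in> carrier G" "y \<in> carrier G"
  have bij: "bij_betw f (carrier G) (carrier G)" using f by (simp add: digraph_auts_def Bij_def)
  have arc: "(f u, f v) \<in> parcs (Cay G prism) \<longleftrightarrow> (u, v) \<in> parcs (Cay G prism)"
    if "u \<in> carrier G" "v \<in> carrier G" for u v
    using f that by (simp add: digraph_auts_def)
  have closed [simp]: "f u \<in> carrier G" if "u \<in> carrier G" for u
    using bij that by (auto simp: bij_betw_def)
  have inj: "f u = f v \<longleftrightarrow> u = v" if "u \<in> carrier G" "v \<in> carrier G" for u v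
    using bij inj_on_eq_iff[of f "carrier G"] that by (simp add: bij_betw_def)
  have ball: "(\<forall>u\<in>carrier G. P u) \<longleftrightarrow> (\<forall>u\<in>carrier G. P (f u))"
    and bex: "(\<exists>u\<in>carrier G. P u) \<longleftrightarrow> (\<exists>u\<in>carrier G. P (f u))" for P
    using bij by (auto simp: bij_betw_def) (metis imageE)+
  have rung: "rung (f u) (f v) \<longleftrightarrow> rung u v" if uv: "u \<in> carrier G" "v \<in> carrier G" for u v
    unfolding rung_def
    by (subst ball, subst bex) (simp add: arc inj uv cong: ball_cong bex_cong conj_cong del: Cay_simps)
  obtain k \<delta> where k: "f (el 0 False) = el k \<delta>" by (meson closed el_cases el_closed)
  have neighbour: "\<exists>t. (t = 1 \<or> t = - 1) \<and> f (el (i + 1) False) = el (l + t) \<delta>"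
    if l: "f (el i False) = el l \<delta>" for i l
  proof -
    obtain m d where m: "f (el (i + 1) False) = el m d" by (meson closed el_cases el_closed)
    have "(el l \<delta>, el m d) \<in> parcs (Cay G prism)"
      using arc[of "el i False" "el (i + 1) False"] l m by (simp add: arc_prism_iff del: Cay_simps)
    moreover have "\<not> rung (el l \<delta>) (el m d)"
      using rung[of "el i False" "el (i + 1) False"] l m by (simp add: rung_iff[OF n])
    ultimately have "d = \<delta>" "[m = l + 1] (mod int n) \<or> [m = l + - 1] (mod int n)"
      unfolding arc_prism_iff rung_iff[OF n] by (auto split: if_splits)
    then have "el m d = el (l + 1) \<delta> \<or> el m d = el (l + - 1) \<delta>" by (simp add: el_eq_iff)
    then show ?thesis unfolding m by blast
  qed
  obtain s where s: "s = 1 \<or> s = - 1" "f (el 1 False) = el (k + s) \<delta>" using neighbour[OF k] by auto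
  have "f (el (int m) False) = el (k + s * int m) \<delta> \<and>
      f (el (int m + 1) False) = el (k + s * (int m + 1)) \<delta>" for m
  proof (induction m)
    case 0
    then show ?case using k s(2) by simp
  next
    case (Suc m)
    obtain t where t: "t = 1 \<or> t = - 1" "f (el (int m + 1 + 1) False) = el (k + s * (int m + 1) + t) \<delta>"
      using neighbour[of "int m + 1" "k + s * (int m + 1)"] Suc by blast
    have "\<not> int n dvd 2" using n by (auto dest: zdvd_imp_le)
    then have "el (int m + 1 + 1) False \<noteq> el (int m) False" by (simp add: el_eq_iff cong_iff_dvd_diff)
    then have "el (k + s * (int m + 1) + t) \<delta> \<noteq> el (k + s * int m) \<delta>"
      using inj[of "el (int m + 1 + 1) False" "el (int m) False"] t(2) Suc by simp
    moreover have "k + s * (int m + 1) + t = k + s * int m + (s + t)" by (simp add: algebra_simps)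
    ultimately have "s + t \<noteq> 0" by auto
    then have "t = s" using s(1) t(1) by auto
    then show ?case using t(2) Suc by (simp add: algebra_simps)
  qed
  then have nat: "f (el (int m) False) = el (k + s * int m) \<delta>" for m by blast
  have rot: "f (el i False) = el (k + s * i) \<delta>" for i
  proof -
    have "int (nat (i mod int n)) = i mod int n" using n by simp
    moreover have "el (i mod int n) False = el i False" by (simp add: el_eq_iff cong_def)
    moreover have "el (k + s * (i mod int n)) \<delta> = el (k + s * i) \<delta>"
      by (intro el_cong cong_add cong_mult cong_refl) (simp add: cong_def)
    ultimately show ?thesis using nat[of "nat (i mod int n)"] by simp
  qed
  have ref: "f (el i True) = el (- k + s * i) (\<not> \<delta>)" for i
  proof -
    obtain m d where m: "f (el i True) = el m d" by (meson closed el_cases el_closed)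
    have "rung (el (k + s * (- i)) \<delta>) (el m d)"
      using rung[of "el (- i) False" "el i True"] by (simp add: rung_iff[OF n] rot m)
    then show ?thesis unfolding rung_iff[OF n] m by (auto simp: el_eq_iff)
  qed
  have "affine s (\<lambda>e. if e then - k else k) \<delta> f"
    unfolding affine_def
  proof (intro allI)
    fix i e
    show "f (el i e) = el (s * i + (if e then - k else k)) (e \<noteq> \<delta>)"
      using rot[of i] ref[of i] by (cases e) (auto simp: add.commute)
  qed
  then show "f (x \<otimes> y) = f x \<otimes> inv (f \<one>) \<otimes> f y"
    by (rule affine_imp_translate[OF _ _ xy]) simp
qed

text \<open>The prism has a second regular dihedral group of automorphisms, whose rotations exchange its
  two rims; relative to it the connection set consists of three reflections.\<close>

lemma not_NCI_group:
  assumes n: "n \<ge> 5" "even n"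
  shows "\<not> NCI_group G"
proof
  assume NCI: "NCI_group G"
  define T where "T = {el 0 True, el 1 True, el 2 True}"
  have T: "connection_set G T"
    by (auto simp: connection_set_def T_def one_el el_eq_iff)
  have Tc: "T \<subseteq> carrier G" by (auto simp: T_def)
  have inv: "set_inv prism = prism"
    by (auto simp: SET_INV_def prism_def inv_el)
  have even_cong: "even i \<longleftrightarrow> even j" if "[i = j] (mod int n)" for i j
  proof -
    have "[i = j] (mod 2)" by (rule cong_dvd_modulus[OF that]) (use n(2) in simp)
    then show ?thesis by (simp add: cong_def even_iff_mod_2_eq_zero)
  qed
  \<comment> \<open>For even \<open>n\<close> the prism is bipartite, and \<open>E\<close> sends one
    part to the rotations and the other to the reflections. \<open>F\<close> is chosen so that rungs
    become edges of \<open>a b\<close>, and rim edges become alternately edges of \<open>b\<close>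
    and of \<open>a^2 b\<close>.\<close>
  define F :: "int \<Rightarrow> bool \<Rightarrow> int" where
    "F i e = (if even i then if e then i + 1 else i else if e then - i else 1 - i)" for i e
  define E :: "int \<Rightarrow> bool \<Rightarrow> bool" where "E i e = (if even i then e else \<not> e)" for i e
  obtain f where f: "f \<in> Bij (carrier G)" "\<And>i e. f (el i e) = el (F i e) (E i e)"
  proof (rule coordinate_bij[of F E])
    fix i j :: int and e assume ij: "[i = j] (mod int n)"
    show "[F i e = F j e] (mod int n) \<and> E i e = E j e"
      using even_cong[OF ij] ij by (auto simp: F_def E_def cong_minus_minus_iff intro: cong_add cong_diff)
  next
    fix i j :: int and e e'
    assume a: "[F i e = F j e'] (mod int n)" "E i e = E j e'"
    have ev: "even (F i e) \<longleftrightarrow> even (F j e')" by (rule even_cong[OF a(1)])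
    have "even i \<longleftrightarrow> even j" "e = e'"
      using ev a(2) by (auto simp: F_def E_def split: if_splits)
    moreover from this have "[i = j] (mod int n)"
      using a(1) by (auto simp: F_def cong_add_rcancel cong_minus_minus_iff cong_iff_dvd_diff dvd_diff_commute split: if_splits)
    ultimately show "[i = j] (mod int n) \<and> e = e'" by simp
  qed auto
  have arcs: "(u, v) \<in> parcs (Cay G prism) \<longleftrightarrow> (f u, f v) \<in> parcs (Cay G T)"
    if uv: "u \<in> carrier G" "v \<in> carrier G" for u v
  proof -
    obtain i e where u: "u = el i e" using uv(1) by (rule el_cases)
    obtain j e' where v: "v = el j e'" using uv(2) by (rule el_cases)
    have T_True: "el m True \<in> T \<longleftrightarrow> int n dvd m \<or> int n dvd m - 1 \<or> int n dvd m - 2" for m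
      by (simp add: T_def el_eq_iff cong_iff_dvd_diff)
    have T_False: "el m False \<notin> T" for m by (simp add: T_def el_eq_iff)
    have even_dvd: "even m" if "int n dvd m" for m using that n(2) by (meson dvd_trans even_of_nat)
    have neg: "int n dvd 1 - m \<longleftrightarrow> int n dvd m - 1" "int n dvd - 1 - m \<longleftrightarrow> int n dvd m + 1" for m
      using dvd_minus_iff[of "int n" "m - 1"] dvd_minus_iff[of "int n" "m + 1"] by (simp_all add: algebra_simps)
    have parity: "odd m \<Longrightarrow> \<not> int n dvd m" "even m \<Longrightarrow> \<not> int n dvd m + 1" "even m \<Longrightarrow> \<not> int n dvd m - 1" for m
      using even_dvd[of m] even_dvd[of "m + 1"] even_dvd[of "m - 1"] by auto
    show ?thesis
    proof (cases "e = e'")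
      case True
      define d where "d = j - i"
      have j: "j = i + d" by (simp add: d_def)
      show ?thesis
        unfolding u v f(2) arc_prism_iff arc_el_iff[OF Tc] T_True cong_iff_dvd_diff True j
        using parity[of d] neg[of d] minus_diff_commute[of d 1]
        by (cases "even i"; cases "even d"; cases e') (simp_all add: F_def E_def T_False algebra_simps disj_commute)
    next
      case False
      then have e: "e' = (\<not> e)" by auto
      define t where "t = i + j"
      have j: "j = t - i" by (simp add: t_def)
      show ?thesis
        unfolding u v f(2) arc_prism_iff arc_el_iff[OF Tc] T_True cong_iff_dvd_diff e j
        using parity[of t] neg[of t] minus_diff_commute[of t 1]
        by (cases "even i"; cases "even t"; cases e) (simp_all add: F_def E_def T_False algebra_simps disj_commute)
    qed
  qed
  have "bij_betw f (carrier G) (carrier G)" using f(1) by (simp add: Bij_def)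
  then have "digraph_iso (with_proj (Cay G prism)) (with_proj (Cay G T))"
    unfolding digraph_iso_Cay_iff[OF is_group connection_set_prism T] using arcs by blast
  moreover have "CI_Cay G prism"
    using NCI connection_set_prism inv normal_prism[OF n(1)] by (simp add: NCI_group_def)
  ultimately obtain \<alpha> where \<alpha>: "\<alpha> \<in> auto G" "\<alpha> ` prism = T" using T by (auto simp: CI_Cay_def)
  have hom: "\<alpha> \<in> hom G G" and inj: "inj_on \<alpha> (carrier G)"
    using \<alpha>(1) by (auto simp: auto_def Bij_def bij_betw_def)
  \<comment> \<open>\<open>T\<close> consists of reflections, so the automorphism would send
    \<open>a\<close>, of order \<open>n\<close>, to an involution.\<close>
  have "\<alpha> (el 1 False) \<in> T" using \<alpha>(2) by (auto simp: prism_def)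
  then have "\<alpha> (el 1 False) \<otimes> \<alpha> (el 1 False) = \<one>" by (auto simp: T_def el_mult one_el)
  then have "\<alpha> (el 2 False) = \<alpha> (el 0 False)"
    using hom_mult[OF hom, of "el 1 False" "el 1 False"] hom_one[OF hom is_group is_group]
    by (simp add: el_mult one_el)
  then have "el 2 False = el 0 False" using inj by (auto dest: inj_onD)
  then have "int n dvd 2" by (simp add: el_eq_iff cong_0_iff)
  then show False using n by (auto dest: zdvd_imp_le)
qed

end

section \<open>The presented dihedral groups\<close>

text \<open>\<open>dih_nf\<close> encodes exponents in the range below \<open>n\<close>, hence the
  reduction; equality and products are then read off the normal forms computed by
  \<open>dih_val\<close>.\<close>

lemma dihedral_coords_dihedral_group:
  assumes n: "n \<ge> 2"
  shows "dihedral_coords (dihedral_group n) n (\<lambda>i e. pres_class (dihedral_rels n) (dih_nf (i mod int n, e)))"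
proof -
  interpret group "dihedral_group n" unfolding dihedral_group_def by (rule group_presented_group)
  have n1: "n \<ge> 1" using n by simp
  have val: "dih_val n (dih_nf (i mod int n, e)) = (i mod int n, e)" for i e
    using n1 by (intro dih_val_nf) auto
  have eq: "pres_class (dihedral_rels n) u = pres_class (dihedral_rels n) v \<longleftrightarrow> dih_val n u = dih_val n v" for u v
    by (simp add: pres_class_eq_iff pres_eq_dihedral_iff[OF n1])
  show ?thesis
  proof
    show "2 \<le> n" by (rule n)
    show "carrier (dihedral_group n) = {pres_class (dihedral_rels n) (dih_nf (i mod int n, e)) | i e. True}"
    proof (intro equalityI subsetI)
      fix x assume "x \<in> carrier (dihedral_group n)"
      then obtain w where w: "x = pres_class (dihedral_rels n) w"
        by (auto simp: dihedral_group_def presented_group_carrier)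
      obtain i e where ie: "dih_val n w = (i, e)" by (cases "dih_val n w")
      have "i mod int n = i" using dih_val_range[OF n1, of w] ie by simp
      then have "x = pres_class (dihedral_rels n) (dih_nf (i mod int n, e))"
        using val[of i e] ie by (simp add: w eq)
      then show "x \<in> {pres_class (dihedral_rels n) (dih_nf (i mod int n, e)) | i e. True}" by blast
    qed (auto simp: dihedral_group_def presented_group_carrier)
  next
    fix i j :: int and e e'
    show "pres_class (dihedral_rels n) (dih_nf (i mod int n, e)) =
        pres_class (dihedral_rels n) (dih_nf (j mod int n, e')) \<longleftrightarrow> [i = j] (mod int n) \<and> e = e'"
      by (simp add: eq val cong_def)
    have "dih_val n (dih_nf (i mod int n, e) @ dih_nf (j mod int n, e')) =
        ((if e then i - j else i + j) mod int n, e \<noteq> e')"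
      using val[of j e'] n1
      by (cases e) (simp_all add: dih_nf_def[of "(i mod int n, _)"] dih_val_pow[OF n1] mod_simps add.commute)
    then show "pres_class (dihedral_rels n) (dih_nf (i mod int n, e)) \<otimes>\<^bsub>dihedral_group n\<^esub>
        pres_class (dihedral_rels n) (dih_nf (j mod int n, e')) =
        pres_class (dihedral_rels n) (dih_nf ((if e then i - j else i + j) mod int n, e \<noteq> e'))"
      unfolding dihedral_group_def presented_group_mult by (simp add: eq val)
  qed
qed

theorem theorem1p1:
  fixes n :: nat
  assumes "n \<ge> 2"
  shows "(NDCI_group (dihedral_group n) \<longleftrightarrow> NCI_group (dihedral_group n)) \<and>
         (NCI_group (dihedral_group n) \<longleftrightarrow> n \<in> {2, 4} \<or> odd n)"
proof -
  interpret dihedral_coords "dihedral_group n" n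
      "\<lambda>i e. pres_class (dihedral_rels n) (dih_nf (i mod int n, e))"
    by (rule dihedral_coords_dihedral_group[OF assms])
  have "NCI_group (dihedral_group n)" if "NDCI_group (dihedral_group n)"
    using that by (simp add: NDCI_group_def NCI_group_def)
  moreover have "NDCI_group (dihedral_group n)" if n: "n \<in> {2, 4} \<or> odd n"
    unfolding NDCI_group_def CI_Cay_def
  proof (intro allI impI; elim conjE)
    fix S T
    assume S: "connection_set (dihedral_group n) S" and T: "connection_set (dihedral_group n) T"
      and normal: "normal_Cay (dihedral_group n) S"
      and iso: "digraph_iso (with_proj (Cay (dihedral_group n) S)) (with_proj (Cay (dihedral_group n) T))"
    obtain f where f: "bij_betw f (carrier (dihedral_group n)) (carrier (dihedral_group n))"
      "\<forall>u\<in>carrier (dihedral_group n). \<forall>v\<in>carrier (dihedral_group n).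
        (u, v) \<in> parcs (Cay (dihedral_group n) S) \<longleftrightarrow> (f u, f v) \<in> parcs (Cay (dihedral_group n) T)"
      using iso unfolding digraph_iso_Cay_iff[OF is_group S T] by blast
    interpret iso: dihedral_Cay_iso "dihedral_group n" n
        "\<lambda>i e. pres_class (dihedral_rels n) (dih_nf (i mod int n, e))" S T f
      by unfold_locales (use S T f in blast)+
    show "\<exists>\<alpha>\<in>auto (dihedral_group n). \<alpha> ` S = T"
    proof (cases "n = 2")
      case False
      interpret normal_dihedral_Cay_iso "dihedral_group n" n
          "\<lambda>i e. pres_class (dihedral_rels n) (dih_nf (i mod int n, e))" S T f
        by unfold_locales (use normal False assms in auto)
      show ?thesis using n False auto_if_odd auto_if_4 by blast
    qed (rule iso.auto_if_2)
  qed
  moreover have "n \<in> {2, 4} \<or> odd n" if "NCI_group (dihedral_group n)"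
  proof (rule ccontr)
    assume "\<not> (n \<in> {2, 4} \<or> odd n)"
    then have "even n" "n \<ge> 5" using assms by (auto elim!: evenE)
    then show False using not_NCI_group that by blast
  qed
  ultimately show ?thesis by blast
qed

end
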